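(* For $d\ge2$ let $\Pi_T$ be the order transform of the $d$-dimensional product copula $\Pi$. For every $k\in\{2,\dots,d\}$, $$\big[\varrho_{\{1,\dots,k\}}(\Pi_T),\varrho_{\{1,\dots,k\}}(\Pi_T)\big]=\frac12-\frac14\sum_{h=2}^k\frac{1}{2h-1}\binom{2h}{h}\binom{2d+2-2h}{d+1-h}\bigg/\binom{2d}{d}=\frac{1}{d+1}+\frac{1}{2d}\sum_{l=1}^{d-k}\binom{d}{l-1}\binom{d}{l}\bigg/\binom{2d-1}{2l-1}.$$ In particular, $$\kappa[\varrho_{\{1,\dots,k\}}(\Pi_T)]=1-\frac{2^{k-2}}{2^{k-1}-1}\sum_{h=2}^k\frac{1}{2h-1}\binom{2h}{h}\binom{2d+2-2h}{d+1-h}\bigg/\binom{2d}{d}$$ holds for every $k\in\{2,\dots,d\}$; for fixed $d$ the sequence $\{\kappa[\varrho_{\{1,\dots,k\}}(\Pi_T)]\}_{k\in\{2,\dots,d\}}$ is decreasing with $$\kappa[\varrho_{\{1,\dots,d\}}(\Pi_T)]=\frac{1}{d+1};$$ and for every fixed integer $k\ge2$ the sequence $\{\kappa[\varrho_{\{1,\dots,k\}}(\Pi_T)]\}_{d\in\{k,k+1,\dots\}}$ is increasing with $$\lim_{d\to\infty}\kappa[\varrho_{\{1,\dots,k\}}(\Pi_T)]=1-\frac{2^{k-2}}{2^{k-1}-1}\sum_{h=2}^k\frac{1}{2h-1}\binom{2h}{h}\frac{1}{2^{2h-2}}.$$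
   Context: Notation: $\overline{\mathbb R}=[-\infty,\infty]$. The product copula is $\Pi(\mathbf u)=\prod_{k=1}^d u_k$ on $[0,1]^d$. For a copula $C$ on $[0,1]^n$, $Q^C$ is the unique Borel probability measure on $[0,1]^n$ with $Q^C[[\mathbf 0,\mathbf u]]=C(\mathbf u)$ for all $\mathbf u\in[0,1]^n$. Kendall's tau: for $n$-dimensional copulas $C,D$ ($n\ge2$) put $[C,D]:=\int_{[0,1]^n}C(\mathbf u)\,dQ^D(\mathbf u)$ and $\kappa[C]:=\dfrac{2^n[C,C]-1}{2^{n-1}-1}$. Margin: for $k\in\{2,\dots,d\}$ and a copula $C$ on $[0,1]^d$, $\varrho_{\{1,\dots,k\}}(C)$ is the $k$-dimensional copula $(v_1,\dots,v_k)\mapsto C(v_1,\dots,v_k,1,\dots,1)$. Order transform: $T:\overline{\mathbb R}^d\to\overline{\mathbb R}^d$ is $(T(\mathbf x))_k:=\min_{J\subseteq\{1,\dots,d\},|J|=k}\max_{l\in J}x_l$, i.e. $T(\mathbf x)$ is the nondecreasing rearrangement of $\mathbf x$. For a copula $C$, let $H^C:\overline{\mathbb R}^d\to[0,1]$ be the distribution function extending $C$, i.e. $H^C(\mathbf x)=C(h(x_1),\dots,h(x_d))$ with $h(x)=\max\{0,\min\{x,1\}\}$, and let $Q^{H^C}$ be the corresponding probability measure. Let $H^C_T$ be the distribution function of the image measure $(Q^{H^C})_T=Q^{H^C}\circ T^{-1}$. Its univariate marginal distribution functions $(H^C_T)_1,\dots,(H^C_T)_d$ are continuous, so there is a unique copula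 $C_T$, called the order transform of $C$, with $H^C_T(\mathbf x)=C_T\big((H^C_T)_1(x_1),\dots,(H^C_T)_d(x_d)\big)$ for all $\mathbf x\in\overline{\mathbb R}^d$.
   Formalization: The printed value κ[ϱ_{1,…,d}(Π_T)] = 1/(d+1) is false (for d = 3 it is 1/3); it is replaced by [ϱ_{1,…,d}(Π_T), ϱ_{1,…,d}(Π_T)] = 1/(d+1) and κ = (2^d/(d+1) − 1)/(2^{d−1} − 1). "Decreasing" and "increasing" are proved strictly. *)

theory Defs
  imports "HOL-Probability.Probability"
begin

text \<open>
  The dimension varies inside the results, so vectors of length n are functions on nat that are
  extensional on {1..n}, and functions on the cube are extensional on the cube. Extensionality is
  what makes the definite descriptions below unique.
\<close>

definition cube :: "nat \<Rightarrow> (nat \<Rightarrow> real) set" where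
  "cube n = (\<Pi>\<^sub>E i\<in>{1..n}. {0..1})"

definition copula :: "nat \<Rightarrow> ((nat \<Rightarrow> real) \<Rightarrow> real) \<Rightarrow> bool" where
  "copula n C \<longleftrightarrow>
     C \<in> cube n \<rightarrow>\<^sub>E {0..1} \<and>
     (\<forall>a\<in>cube n. \<forall>b\<in>cube n. (\<forall>i\<in>{1..n}. a i \<le> b i) \<longrightarrow>
        0 \<le> (\<Sum>J\<in>Pow {1..n}. (-1) ^ card J * C (\<lambda>i\<in>{1..n}. if i \<in> J then a i else b i))) \<and>
     (\<forall>u\<in>cube n. (\<exists>i\<in>{1..n}. u i = 0) \<longrightarrow> C u = 0) \<and>
     (\<forall>k\<in>{1..n}. \<forall>t\<in>{0..1}. C (\<lambda>i\<in>{1..n}. if i = k then t else 1) = t)"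

definition product_copula :: "nat \<Rightarrow> (nat \<Rightarrow> real) \<Rightarrow> real" where
  "product_copula d = (\<lambda>u\<in>cube d. \<Prod>k\<in>{1..d}. u k)"

definition copula_measure :: "nat \<Rightarrow> ((nat \<Rightarrow> real) \<Rightarrow> real) \<Rightarrow> (nat \<Rightarrow> real) measure" where
  "copula_measure n C = (THE Q.
     sets Q = sets (\<Pi>\<^sub>M i\<in>{1..n}. restrict_space borel {0..1}) \<and> prob_space Q \<and>
     (\<forall>u\<in>cube n. measure Q (\<Pi>\<^sub>E i\<in>{1..n}. {0..u i}) = C u))"

definition bracket :: "nat \<Rightarrow> ((nat \<Rightarrow> real) \<Rightarrow> real) \<Rightarrow> ((nat \<Rightarrow> real) \<Rightarrow> real) \<Rightarrow> real" where
  "bracket n C D = (\<integral>u. C u \<partial>copula_measure n D)"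

definition kendall_tau :: "nat \<Rightarrow> ((nat \<Rightarrow> real) \<Rightarrow> real) \<Rightarrow> real" where
  "kendall_tau n C = (2 ^ n * bracket n C C - 1) / (2 ^ (n - 1) - 1)"

definition initial_margin ::
  "nat \<Rightarrow> nat \<Rightarrow> ((nat \<Rightarrow> real) \<Rightarrow> real) \<Rightarrow> (nat \<Rightarrow> real) \<Rightarrow> real" where
  "initial_margin d k C = (\<lambda>v\<in>cube k. C (\<lambda>i\<in>{1..d}. if i \<le> k then v i else 1))"

abbreviation ereal_vecs :: "nat \<Rightarrow> (nat \<Rightarrow> ereal) measure" where
  "ereal_vecs d \<equiv> (\<Pi>\<^sub>M i\<in>{1..d}. borel)"

definition order_map :: "nat \<Rightarrow> (nat \<Rightarrow> ereal) \<Rightarrow> (nat \<Rightarrow> ereal)" where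
  "order_map d x =
     (\<lambda>k\<in>{1..d}. Min ((\<lambda>J. Max (x ` J)) ` {J. J \<subseteq> {1..d} \<and> card J = k}))"

definition copula_df :: "nat \<Rightarrow> ((nat \<Rightarrow> real) \<Rightarrow> real) \<Rightarrow> (nat \<Rightarrow> ereal) \<Rightarrow> real" where
  "copula_df d C x = C (\<lambda>i\<in>{1..d}. real_of_ereal (max 0 (min (x i) 1)))"

definition df_measure :: "nat \<Rightarrow> ((nat \<Rightarrow> ereal) \<Rightarrow> real) \<Rightarrow> (nat \<Rightarrow> ereal) measure" where
  "df_measure d H = (THE Q.
     sets Q = sets (ereal_vecs d) \<and> prob_space Q \<and>
     (\<forall>x\<in>space (ereal_vecs d). measure Q (\<Pi>\<^sub>E i\<in>{1..d}. {..x i}) = H x))"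

definition order_df :: "nat \<Rightarrow> ((nat \<Rightarrow> real) \<Rightarrow> real) \<Rightarrow> (nat \<Rightarrow> ereal) \<Rightarrow> real" where
  "order_df d C x =
     measure (distr (df_measure d (copula_df d C)) (ereal_vecs d) (order_map d))
       (\<Pi>\<^sub>E i\<in>{1..d}. {..x i})"

definition marginal_df :: "nat \<Rightarrow> ((nat \<Rightarrow> ereal) \<Rightarrow> real) \<Rightarrow> nat \<Rightarrow> ereal \<Rightarrow> real" where
  "marginal_df d H k t = H (\<lambda>i\<in>{1..d}. if i = k then t else \<infinity>)"

definition order_transform ::
  "nat \<Rightarrow> ((nat \<Rightarrow> real) \<Rightarrow> real) \<Rightarrow> (nat \<Rightarrow> real) \<Rightarrow> real" where
  "order_transform d C = (THE D. copula d D \<and>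
     (\<forall>x\<in>space (ereal_vecs d).
        order_df d C x = D (\<lambda>i\<in>{1..d}. marginal_df d (order_df d C) i (x i))))"

abbreviation product_order_margin :: "nat \<Rightarrow> nat \<Rightarrow> (nat \<Rightarrow> real) \<Rightarrow> real" where
  "product_order_margin d k \<equiv> initial_margin d k (order_transform d (product_copula d))"

end

theory Submission
  imports Defs "HOL-Real_Asymp.Real_Asymp"
begin

text \<open>
  The margin of $\Pi_T$ is the copula of the first $k$ order statistics of $d$ independent uniform
  variables, so its bracket with itself is the probability that the first $k$ order statistics of
  one sample are dominated by those of an independent second sample. By exchangeability this is the
  proportion of the $d$-subsets of $\{0,\dots,2d-1\}$ whose lattice path stays weakly above the
  diagonal up to its $k$-th down step. Decomposing the remaining paths by their first crossing of the
  diagonal gives the sum of Catalan numbers times central binomial coefficients. The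
  summands $a_h$ are Gosper-summable, which yields the value for $k = d$, and $2 a_{h+1} > a_h$
  gives the monotonicity in $k$.
\<close>

text \<open>The measures and the order transform are definite descriptions, so existence and
  uniqueness are both needed: a pi-lambda argument determines the measures, and surjectivity onto
  [0,1] of the distribution functions F_i of the order statistics determines the copula. The F_i are
  also strictly increasing on [0,1], so they cancel from the bracket and leave a comparison of the
  order statistics themselves. That comparison is restated by counts: Y_(i) <= X_(i) for all i <= k
  iff for every t the number of x_j <= t, cut off at k, is at most the number of y_j <= t. This form
  involves no sorting and reads directly as a condition on the prefixes of a path. The path count
  uses no bijection: the closed formula and the family of sets obey the same Pascal recursion with
  the same boundary values. At k = d it is the bracket that equals 1/(d+1). Kendall's tau is then
  (2^d/(d+1) - 1)/(2^(d-1) - 1), the value proved here; for d >= 2 it agrees with 1/(d+1) only at d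
  = 2 (for d = 3 it is 1/3).\<close>

section \<open>Central binomial sums\<close>

text \<open>The hypergeometric ratio from which the recurrence of \<open>tau_term\<close>, its
  comparison in d and its limit are all read off.\<close>

lemma central_binomial_Suc:
  "real (2 * Suc n choose Suc n) = 2 * (2 * real n + 1) / (real n + 1) * real (2 * n choose n)"
proof -
  have "real (2 * Suc n choose Suc n)
      = (2 * real n + 2) * (2 * real n + 1) * fact (2 * n) / ((real n + 1) * fact n * ((real n + 1) * fact n))"
    by (subst binomial_fact) (auto simp: algebra_simps)
  moreover have "real (2 * n choose n) = fact (2 * n) / (fact n * fact n)"
    by (subst binomial_fact) auto
  ultimately show ?thesis
    by (simp only:) (simp add: divide_simps, simp add: algebra_simps)
qed

text \<open>For 1 <= h <= d this is four times the probability that a uniformly random path with d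
  up and d down steps first crosses the diagonal at its h-th down step; see
  \<open>first_crossing_tau_term\<close>.\<close>

definition tau_term :: "nat \<Rightarrow> nat \<Rightarrow> real" where
  "tau_term d h = 1 / (2 * real h - 1) * real (2 * h choose h)
     * real ((2 * d + 2 - 2 * h) choose (d + 1 - h)) / real (2 * d choose d)"

lemma tau_term_pos: "1 \<le> h \<Longrightarrow> h \<le> d + 1 \<Longrightarrow> 0 < tau_term d h"
  by (auto simp: tau_term_def intro!: divide_pos_pos mult_pos_pos)

lemma tau_term_Suc:
  assumes "1 \<le> h" "h \<le> d"
  shows "tau_term d (Suc h) = (2 * real h - 1) * (real d + 1 - real h)
     / ((real h + 1) * (2 * real d + 1 - 2 * real h)) * tau_term d h"
proof -
  obtain m where d: "d = h + m"
    using assms(2) le_Suc_ex by blast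
  have e: "2 * (h + m) + 2 - 2 * Suc h = 2 * m" "2 * (h + m) + 2 - 2 * h = 2 * Suc m"
    "h + m + 1 - Suc h = m" "h + m + 1 - h = Suc m"
    by auto
  have "2 * real h - 1 > 0" using assms by simp
  moreover have "real (2 * (h+m) choose (h+m)) > 0" by simp
  ultimately show ?thesis
    unfolding tau_term_def d e central_binomial_Suc
    by (simp add: divide_simps del: mult_Suc_right) (simp add: algebra_simps)
qed

text \<open>Gosper telescoping: with G(h) = h (2d+3-2h) / (d+1) * \<open>tau_term d h\<close>, the
  recurrence gives \<open>tau_term d h\<close> = G(h) - G(h+1). The constant 2d/(d+1) is G(2), so
  the induction can start from the empty sum at k = 1.\<close>

lemma sum_tau_term:
  assumes "1 \<le> k" "k \<le> d"
  shows "(\<Sum>h = 2..k. tau_term d h) = 2 * real d / (real d + 1)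
     - (real k + 1) * (2 * real d + 1 - 2 * real k) / (real d + 1) * tau_term d (Suc k)"
  using assms
proof (induction k rule: dec_induct)
  case base
  have "tau_term d 1 = 2"
    by (simp add: tau_term_def)
  with tau_term_Suc[of 1 d] base show ?case
    by (simp add: divide_simps mult.commute)
next
  case (step n)
  have "(\<Sum>h = 2..Suc n. tau_term d h) = (\<Sum>h = 2..n. tau_term d h) + tau_term d (Suc n)"
    using step by simp
  also have "\<dots> = 2 * real d / (real d + 1)
     - (real n + 1) * (2 * real d + 1 - 2 * real n) / (real d + 1) * tau_term d (Suc n)
     + tau_term d (Suc n)"
    using step by simp
  also have "\<dots> = 2 * real d / (real d + 1)
     - (real (Suc n) + 1) * (2 * real d + 1 - 2 * real (Suc n)) / (real d + 1) * tau_term d (Suc (Suc n))"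
  proof -
    have "2 * real d + 1 - 2 * real (Suc n) > 0" using step by simp
    then show ?thesis
      using step by (subst tau_term_Suc[of "Suc n" d]) (auto simp: divide_simps, auto simp: algebra_simps)
  qed
  finally show ?case .
qed

lemma sum_tau_term_full:
  assumes "1 \<le> d"
  shows "1 / 2 - 1 / 4 * (\<Sum>h = 2..d. tau_term d h) = 1 / (real d + 1)"
proof -
  \<comment> \<open>One index past the summation range, where the second binomial degenerates to 0
    choose 0.\<close>
  have "tau_term d (Suc d) = 2 / (real d + 1)"
    unfolding tau_term_def central_binomial_Suc by (simp add: divide_simps)
  then show ?thesis
    using sum_tau_term[of d d] assms by (simp add: field_simps)
qed

text \<open>The two closed forms have the same summands up to the index reversal l = d + 1 - h; both
  sides expand to the same quotient of factorials.\<close>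

lemma tau_term_eq:
  assumes "1 \<le> k" "k \<le> d"
  shows "1 / 4 * tau_term d k = 1 / (2 * real d) * (real (d choose (d - k)) * real (d choose (Suc (d - k)))
     / real ((2 * d - 1) choose (2 * Suc (d - k) - 1)))"
proof -
  obtain j where k: "k = Suc j" using assms(1) by (cases k) auto
  obtain m where d: "d = k + m"
    using assms(2) le_Suc_ex by blast
  have 1: "real ((k + m) choose m) = fact (k + m) / (fact m * fact (Suc j))"
    by (subst binomial_fact) (auto simp: k)
  have 2: "real ((k + m) choose (Suc m)) = fact (k + m) / (fact (Suc m) * fact j)"
    by (subst binomial_fact) (auto simp: k)
  have 3: "real ((2 * (k + m) - 1) choose (2 * Suc m - 1))
       = fact (2 * j + 2 * m + 1) / (fact (2 * m + 1) * fact (2 * j))"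
    by (subst binomial_fact) (auto simp: k)
  have 4: "real (2 * (k + m) choose (k + m))
       = (2 * (real j + real m + 1)) * fact (2 * j + 2 * m + 1) / (fact (k + m) * fact (k + m))"
  proof -
    have "2 * (k + m) = Suc (2 * j + 2 * m + 1)" by (simp add: k)
    then have "fact (2 * (k + m)) = (2 * (real j + real m + 1)) * fact (2 * j + 2 * m + 1)"
      by (simp only: fact_Suc) (simp add: algebra_simps)
    then show ?thesis
      by (subst binomial_fact) (auto simp: add.commute)
  qed
  have 5: "real (2 * k choose k) = (2 * real j + 2) * (2 * real j + 1) * fact (2 * j)
       / ((real j + 1) * fact j * fact (Suc j))"
    by (subst binomial_fact) (auto simp: k algebra_simps)
  have 6: "real (2 * (k + m) + 2 - 2 * k choose (k + m + 1 - k))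
       = (2 * real m + 2) * fact (2 * m + 1) / ((real m + 1) * fact m * fact (Suc m))"
    by (subst binomial_fact) (auto simp: k algebra_simps)
  have 7: "2 * real (Suc j) - 1 = 2 * real j + 1" by simp
  have 8: "real (Suc j + m) = real j + real m + 1" by simp
  have 9: "(k + m) - k = m" by simp
  have pos: "2 * real j + 1 > 0" "real j + real m + 1 > 0" "real m + 1 > 0" "real j + 1 > 0" by auto
  show ?thesis
    unfolding tau_term_def d 9 1 2 3 4 5 6
    unfolding k 7 8 using pos
    by (simp add: divide_simps del: fact_Suc of_nat_Suc) (simp add: algebra_simps del: fact_Suc)
qed

text \<open>Downward induction from k = d, where the right-hand sum is empty and the value is
  1/(d+1). Each decrease of k moves one summand across, in the form given by
  \<open>tau_term_eq\<close>.\<close>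

lemma sum_tau_term_tail:
  assumes "1 \<le> k" "k \<le> d"
  shows "1 / 2 - 1 / 4 * (\<Sum>h = 2..k. tau_term d h)
    = 1 / (real d + 1) + 1 / (2 * real d) * (\<Sum>l = 1..d - k.
                  real (d choose (l - 1)) * real (d choose l)
                    / real ((2 * d - 1) choose (2 * l - 1)))"
  using assms(2,1)
proof (induction k rule: inc_induct)
  case base
  then show ?case using sum_tau_term_full[of d] by simp
next
  case (step n)
  have e: "d - n = Suc (d - Suc n)" using step by simp
  have "1 / 2 - 1 / 4 * (\<Sum>h = 2..n. tau_term d h)
     = 1 / 2 - 1 / 4 * (\<Sum>h = 2..Suc n. tau_term d h) + 1 / 4 * tau_term d (Suc n)"
    using step.hyps step.prems by (simp add: add_divide_distrib)
  also have "\<dots> = 1 / (real d + 1) + 1 / (2 * real d) * (\<Sum>l = 1..d - Suc n.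
      real (d choose (l - 1)) * real (d choose l) / real ((2 * d - 1) choose (2 * l - 1)))
      + 1 / (2 * real d) * (real (d choose (d - Suc n)) * real (d choose (Suc (d - Suc n)))
     / real ((2 * d - 1) choose (2 * Suc (d - Suc n) - 1)))"
    using step tau_term_eq[of "Suc n" d] by simp
  finally show ?case
    unfolding e by (simp add: algebra_simps)
qed

lemma tau_term_half_less:
  assumes "2 \<le> h" "h \<le> d"
  shows "tau_term d h < 2 * tau_term d (Suc h)"
proof -
  define q where "q = (2 * real h - 1) * (real d + 1 - real h)
     / ((real h + 1) * (2 * real d + 1 - 2 * real h))"
  have "(real h + 1) * (2 * real d + 1 - 2 * real h) < 2 * ((2 * real h - 1) * (real d + 1 - real h))"
  proof -
    define m where "m = real d - real h"
    have m: "m \<ge> 0" "real d = real h + m" using assms by (auto simp: m_def)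
    \<comment> \<open>The right side exceeds the left by 2 (h - 2) m + 3 (h - 1), which is positive
      for h >= 2.\<close>
    have "(real h - 2) * m \<ge> 0" using m assms by simp
    then show ?thesis
      using assms unfolding m(2) by (simp add: algebra_simps)
  qed
  moreover have "(real h + 1) * (2 * real d + 1 - 2 * real h) > 0"
    using assms by simp
  ultimately have "1 < 2 * q"
    by (simp add: q_def field_simps)
  moreover have "tau_term d h > 0" using assms by (intro tau_term_pos) auto
  ultimately have "tau_term d h * 1 < tau_term d h * (2 * q)"
    by (rule mult_strict_left_mono)
  then show ?thesis
    using tau_term_Suc[of h d] assms unfolding q_def[symmetric] by (simp add: mult_ac)
qed

text \<open>Iterating \<open>tau_term_half_less\<close> bounds the summand at h by 2^(k+1-h) times
  the one at k + 1. These factors add up to 2^k - 2, exactly the constant that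
  \<open>tau_formula_antimono\<close> requires.\<close>

lemma sum_tau_term_less:
  assumes "2 \<le> k" "k \<le> d"
  shows "(\<Sum>h = 2..k. tau_term d h) < (2 ^ k - 2) * tau_term d (Suc k)"
  using assms
proof (induction k rule: dec_induct)
  case base
  then show ?case using tau_term_half_less[of 2 d] by (simp add: numeral_2_eq_2)
next
  case (step n)
  have "(\<Sum>h = 2..Suc n. tau_term d h) < (2 ^ n - 2) * tau_term d (Suc n) + tau_term d (Suc n)"
    using step by simp
  also have "\<dots> = (2 ^ n - 1) * tau_term d (Suc n)" by (simp add: algebra_simps)
  also have "\<dots> \<le> (2 ^ n - 1) * (2 * tau_term d (Suc (Suc n)))"
    using tau_term_half_less[of "Suc n" d] step by (intro mult_left_mono) auto
  finally show ?case by (simp add: algebra_simps)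
qed

text \<open>Reduces monotonicity in k and in d to consecutive indices; the second assumption is
  order convexity of S.\<close>

lemma strict_mono_on_nat_interval:
  fixes f :: "nat \<Rightarrow> real"
  assumes "\<And>n. n \<in> S \<Longrightarrow> Suc n \<in> S \<Longrightarrow> f n < f (Suc n)"
  assumes "\<And>i j m. i \<in> S \<Longrightarrow> j \<in> S \<Longrightarrow> i \<le> m \<Longrightarrow> m \<le> j \<Longrightarrow> m \<in> S"
  shows "strict_mono_on S f"
proof (rule strict_mono_onI)
  fix r s assume rs: "r \<in> S" "s \<in> S" "r < s"
  have "f r < f s" if "Suc r \<le> s" "s \<in> S" for s
    using that
  proof (induction s rule: dec_induct)
    case base
    then show ?case using assms(1) rs by simp
  next
    case (step n)
    then have "n \<in> S" using assms(2)[of r "Suc n" n] rs by simp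
    then show ?case using step assms(1)[of n] by simp
  qed
  then show "f r < f s" using rs by simp
qed

section \<open>Kendall's tau as a function of k and of d\<close>

definition tau_formula :: "nat \<Rightarrow> nat \<Rightarrow> real" where
  "tau_formula d k = 1 - 2 ^ (k - 2) / (2 ^ (k - 1) - 1) * (\<Sum>h = 2..k. tau_term d h)"

text \<open>Raising k enlarges the sum S but lowers its weight from p/(2p-1) to 2p/(4p-1), where p =
  2^(k-2). Clearing denominators, the product grows iff S < (4p-2) t with t the new summand, and
  this is \<open>sum_tau_term_less\<close>.\<close>

lemma tau_formula_antimono:
  "strict_antimono_on {2..d} (tau_formula d)"
proof -
  have "strict_mono_on {2..d} (\<lambda>k. - tau_formula d k)"
  proof (rule strict_mono_on_nat_interval)
    fix k assume k: "k \<in> {2..d}" "Suc k \<in> {2..d}"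
    then obtain j where j: "k = j + 2" by (metis add.commute atLeastAtMost_iff le_Suc_ex)
    define S where "S = (\<Sum>h = 2..k. tau_term d h)"
    define p :: real where "p = 2 ^ j"
    have p: "p \<ge> 1" by (simp add: p_def)
    have "S < (4 * p - 2) * tau_term d (Suc k)"
      using sum_tau_term_less[of k d] k by (simp add: S_def p_def j)
    then have "(2 * p - 1) * (2 * tau_term d (Suc k)) > S" by (simp add: algebra_simps)
    then have "p * S < p * ((2 * p - 1) * (2 * tau_term d (Suc k)))" using p by simp
    then have "p / (2 * p - 1) * S < 2 * p / (4 * p - 1) * (S + tau_term d (Suc k))"
      using p by (simp add: field_simps)
    moreover have "(\<Sum>h = 2..Suc k. tau_term d h) = S + tau_term d (Suc k)"
      using k by (simp add: S_def)
    moreover have "2 ^ (k - 2) = p" "2 ^ (k - 1) = 2 * p" "2 ^ (Suc k - 2) = 2 * p" "2 ^ (Suc k - 1) = 4 * p"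
      by (simp_all add: p_def j)
    ultimately show "- tau_formula d k < - tau_formula d (Suc k)"
      by (simp only: tau_formula_def S_def[symmetric])
  qed auto
  then show ?thesis
    by (auto simp: monotone_on_def)
qed

text \<open>Passing from n to n + 1 multiplies (2n choose n) by 4 - 2/(n+1), which increases with n.
  The denominator has the larger n, so it grows by the larger factor.\<close>

lemma central_binomial_ratio_mono:
  assumes "1 \<le> i" "i \<le> d"
  shows "real (2 * (Suc d - i) choose (Suc d - i)) / real (2 * Suc d choose Suc d)
       < real (2 * (d - i) choose (d - i)) / real (2 * d choose d)"
proof -
  obtain m where d: "d = i + m" using assms(2) le_Suc_ex by blast
  have e: "Suc d - i = Suc m" "d - i = m" by (auto simp: d)
  have "2 * (2 * real m + 1) / (real m + 1) < 2 * (2 * real d + 1) / (real d + 1)"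
    using assms by (simp add: d field_simps)
  moreover have "real (2 * m choose m) > 0" "real (2 * d choose d) > 0" by auto
  ultimately show ?thesis
    unfolding e central_binomial_Suc by (simp add: divide_simps) (simp add: algebra_simps)
qed

text \<open>Only the quotient of central binomials depends on d. Its shift is h - 1, which h >= 2
  makes positive.\<close>

lemma tau_term_less_Suc:
  assumes "2 \<le> h" "h \<le> d"
  shows "tau_term (Suc d) h < tau_term d h"
proof -
  have e: "2 * Suc d + 2 - 2 * h = 2 * (Suc d - (h - 1))" "2 * d + 2 - 2 * h = 2 * (d - (h - 1))"
    "Suc d + 1 - h = Suc d - (h - 1)" "d + 1 - h = d - (h - 1)" using assms by auto
  show ?thesis
    unfolding tau_term_def e times_divide_eq_right[symmetric]
    using assms by (intro mult_strict_left_mono central_binomial_ratio_mono) auto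
qed

lemma tau_formula_mono:
  assumes "2 \<le> k"
  shows "strict_mono_on {k..} (\<lambda>d. tau_formula d k)"
proof (rule strict_mono_on_nat_interval)
  fix d assume d: "d \<in> {k..}" "Suc d \<in> {k..}"
  have "(\<Sum>h = 2..k. tau_term (Suc d) h) < (\<Sum>h = 2..k. tau_term d h)"
    using assms d by (intro sum_strict_mono tau_term_less_Suc) auto
  moreover have "(1::real) < 2 ^ (k - 1)" using assms by (intro one_less_power) auto
  ultimately show "tau_formula d k < tau_formula (Suc d) k"
    unfolding tau_formula_def by (simp add: divide_strict_right_mono)
qed auto

text \<open>Each further unit of shift contributes a factor (m+1)/(2(2m+1)) with m = d - i - 1,
  which tends to 1/4.\<close>

lemma central_binomial_ratio_tendsto:
  "(\<lambda>d. real (2 * (d - i) choose (d - i)) / real (2 * d choose d)) \<longlonglongrightarrow> 1 / 4 ^ i"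
proof (induction i)
  case 0
  then show ?case by simp
next
  case (Suc i)
  have "(\<lambda>m. (real m + 1) / (2 * (2 * real m + 1))) \<longlonglongrightarrow> 1 / 4"
    by real_asymp
  then have "(\<lambda>d. (real (d - Suc i) + 1) / (2 * (2 * real (d - Suc i) + 1))) \<longlonglongrightarrow> 1 / 4"
    by (rule filterlim_compose) (rule filterlim_minus_const_nat_at_top)
  then have "(\<lambda>d. (real (d - Suc i) + 1) / (2 * (2 * real (d - Suc i) + 1))
     * (real (2 * (d - i) choose (d - i)) / real (2 * d choose d))) \<longlonglongrightarrow> 1 / 4 * (1 / 4 ^ i)"
    using Suc by (rule tendsto_mult)
  \<comment> \<open>The factorization fails while the subtraction d - (i+1) is truncated, hence only
    eventually.\<close>
  moreover have "\<forall>\<^sub>F d in sequentially. (real (d - Suc i) + 1) / (2 * (2 * real (d - Suc i) + 1))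
     * (real (2 * (d - i) choose (d - i)) / real (2 * d choose d))
     = real (2 * (d - Suc i) choose (d - Suc i)) / real (2 * d choose d)"
    using eventually_ge_at_top[of "Suc i"]
  proof eventually_elim
    case (elim d)
    then have "d - i = Suc (d - Suc i)" by simp
    moreover have "2 * real (d - Suc i) + 1 > 0" "real (d - Suc i) + 1 > 0" by auto
    ultimately show ?case by (simp add: central_binomial_Suc divide_simps del: mult_Suc_right)
  qed
  ultimately show ?case
    by (simp add: Lim_transform_eventually)
qed

lemma tau_formula_tendsto:
  "(\<lambda>d. tau_formula d k) \<longlonglongrightarrow> 1 - 2 ^ (k - 2) / (2 ^ (k - 1) - 1)
                  * (\<Sum>h = 2..k. 1 / (2 * real h - 1) * real (2 * h choose h)
                      * (1 / 2 ^ (2 * h - 2)))"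
  unfolding tau_formula_def
proof (intro tendsto_intros tendsto_sum)
  fix h assume h: "h \<in> {2..k}"
  have e: "2 * d + 2 - 2 * h = 2 * (d - (h - 1))" "d + 1 - h = d - (h - 1)" if "d \<ge> h" for d
    using that h by auto
  have "2 * h - 2 = 2 * (h - 1)" by simp
  then have e2: "(2::real) ^ (2 * h - 2) = 4 ^ (h - 1)"
    by (simp add: power_mult)
  have "(\<lambda>d. 1 / (2 * real h - 1) * real (2 * h choose h) *
      (real (2 * (d - (h - 1)) choose (d - (h - 1))) / real (2 * d choose d)))
     \<longlonglongrightarrow> 1 / (2 * real h - 1) * real (2 * h choose h) * (1 / 4 ^ (h - 1))"
    by (intro tendsto_intros central_binomial_ratio_tendsto)
  then show "(\<lambda>d. tau_term d h) \<longlonglongrightarrow> 1 / (2 * real h - 1) * real (2 * h choose h) * (1 / 2 ^ (2 * h - 2))"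
    unfolding e2
    by (rule Lim_transform_eventually)
       (use eventually_ge_at_top[of h] in eventually_elim, simp only: tau_term_def e times_divide_eq_right)
qed

section \<open>Counting lattice paths\<close>

text \<open>The reflection principle: for b <= a + 1 this counts the paths with a up and b down
  steps that never go below the diagonal. It is a Catalan number for a = b and negative for b > a +
  1, hence the type int.\<close>

definition ballot :: "nat \<Rightarrow> nat \<Rightarrow> int" where
  "ballot a b = int (a + b choose b) - int (a + b choose Suc a)"

lemma ballot_Suc_Suc: "ballot (Suc a) (Suc b) = ballot a (Suc b) + ballot (Suc a) b"
  by (simp add: ballot_def)

lemma ballot_pred: "ballot a (Suc a) = 0"
  by (simp add: ballot_def)

lemma ballot_0_right: "ballot a 0 = 1"
  by (simp add: ballot_def)

text \<open>
  The number of paths with a up steps and b down steps that first cross the diagonal at their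
  (j+1)-st down step: a Dyck path of semilength j, a down step, and an arbitrary rest.
\<close>

definition first_crossing :: "nat \<Rightarrow> nat \<Rightarrow> nat \<Rightarrow> int" where
  "first_crossing j a b = (if j < b \<and> j \<le> a
     then ballot j j * int ((a + b - 1 - 2 * j) choose (a - j)) else 0)"

text \<open>The rest after the crossing obeys Pascal's rule. The one exception is the point (j, j+1)
  reached by the crossing step itself: the rest is empty there and both predecessors have count
  0.\<close>

lemma first_crossing_Suc_Suc:
  "first_crossing j (Suc a) (Suc b) = first_crossing j a (Suc b) + first_crossing j (Suc a) b
     + (if j = Suc a \<and> j = b then ballot j j else 0)"
proof (cases "j \<le> a \<and> j < b")
  case True
  define p q where "p = a - j" and "q = b - j - 1"
  have ab: "a = j + p" "b = Suc (j + q)"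
    using True by (auto simp: p_def q_def)
  show ?thesis
    by (simp add: first_crossing_def ab algebra_simps)
next
  case False
  then consider "j \<le> a" "j = b" | "j = Suc a" "j < b" | "j = Suc a" "j = b" | "j > Suc a \<or> j > b"
    by linarith
  then show ?thesis
    by cases (auto simp: first_crossing_def)
qed

text \<open>Of all paths, those crossing the diagonal with one of their first k down steps are
  removed; index j stands for the (j+1)-st down step.\<close>

definition dominating_count :: "nat \<Rightarrow> nat \<Rightarrow> nat \<Rightarrow> int" where
  "dominating_count k a b = int (a + b choose a) - (\<Sum>j<k. first_crossing j a b)"

text \<open>The correction removes the paths that reach (b, b) and would cross with their next down
  step; it applies only while that step is among the first k.\<close>

lemma dominating_count_Suc_Suc:
  "dominating_count k (Suc a) (Suc b) = dominating_count k a (Suc b) + dominating_count k (Suc a) b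
     - (if Suc a < k \<and> b = Suc a then ballot b b else 0)"
proof -
  have "(\<Sum>j<k. if j = Suc a \<and> j = b then ballot j j else 0)
      = (if b = Suc a then \<Sum>j<k. if j = b then ballot j j else 0 else 0)"
    by (auto intro!: sum.cong sum.neutral)
  also have "\<dots> = (if Suc a < k \<and> b = Suc a then ballot b b else 0)"
    by (auto simp: sum.delta)
  finally show ?thesis
    unfolding dominating_count_def first_crossing_Suc_Suc sum.distrib by simp
qed

lemma dominating_count_0_right: "dominating_count k a 0 = 1"
  by (simp add: dominating_count_def first_crossing_def)

lemma dominating_count_0_left:
  assumes "0 < k" "0 < b"
  shows "dominating_count k 0 b = 0"
proof -
  have "(\<Sum>j<k. first_crossing j 0 b) = (\<Sum>j<k. if j = 0 then 1 else 0)"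
    using assms by (intro sum.cong) (auto simp: first_crossing_def ballot_def)
  then show ?thesis
    using assms by (simp add: dominating_count_def)
qed

text \<open>Below the diagonal a crossing has already happened; with at most k down steps all of
  them are constrained, so the full ballot number appears. The claims need a joint induction: just
  below the diagonal the correction cancels the ballot number of the diagonal, and the ballot
  recursion at b = a + 1 uses a zero from below.\<close>

lemma dominating_count_boundary:
  assumes "0 < k"
  shows "(a < k \<and> a < b \<longrightarrow> dominating_count k a b = 0)
     \<and> (b \<le> k \<and> b \<le> Suc a \<longrightarrow> dominating_count k a b = ballot a b)"
proof (induction "a + b" arbitrary: a b rule: less_induct)
  case less
  consider "a = 0" | "b = 0" | a' b' where "a = Suc a'" "b = Suc b'"
    by (meson not0_implies_Suc)
  then show ?case
  proof cases
    case 1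
    then show ?thesis
      using dominating_count_0_left[OF assms, of b] ballot_pred[of 0]
      by (cases "b = 0") (auto simp: ballot_0_right dominating_count_0_right le_Suc_eq)
  next
    case 2
    then show ?thesis by (simp add: dominating_count_0_right ballot_0_right)
  next
    case 3
    have IH: "a' < k \<and> a' < b \<longrightarrow> dominating_count k a' b = 0"
      "b \<le> k \<and> b \<le> Suc a' \<longrightarrow> dominating_count k a' b = ballot a' b"
      "a < k \<and> a < b' \<longrightarrow> dominating_count k a b' = 0"
      "b' \<le> k \<and> b' \<le> Suc a \<longrightarrow> dominating_count k a b' = ballot a b'"
      using less[of a' b] less[of a b'] 3 by auto
    have rec: "dominating_count k a b = dominating_count k a' b + dominating_count k a b'
       - (if a < k \<and> b' = a then ballot b' b' else 0)"
      using dominating_count_Suc_Suc[of k a' b'] 3 by simp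
    show ?thesis
    proof (intro conjI impI)
      assume h: "a < k \<and> a < b"
      then consider "b' = a" | "a < b'" using 3 by linarith
      then show "dominating_count k a b = 0"
        using rec IH h 3 by cases auto
    next
      assume h: "b \<le> k \<and> b \<le> Suc a"
      then consider "b' = a" | "b \<le> a" using 3 by linarith
      then show "dominating_count k a b = ballot a b"
      proof cases
        case 1
        then show ?thesis using rec IH h 3 by (auto simp: ballot_pred)
      next
        case 2
        then show ?thesis using rec IH h 3 by (auto simp: ballot_Suc_Suc)
      qed
    qed
  qed
qed

text \<open>B codes a path of n steps whose up steps sit at the positions in B. The cut-off at k
  constrains the path only up to its k-th down step: from then on at least k up steps are present
  and the condition persists.\<close>

definition dominating_sets :: "nat \<Rightarrow> nat \<Rightarrow> nat \<Rightarrow> nat set set" where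
  "dominating_sets k n a = {B. B \<subseteq> {..<n} \<and> card B = a \<and>
     (\<forall>m\<le>n. min k (card ({..<m} - B)) \<le> card ({..<m} \<inter> B))}"

lemma finite_dominating_sets: "finite (dominating_sets k n a)"
  by (rule finite_subset[of _ "Pow {..<n}"]) (auto simp: dominating_sets_def)

text \<open>The prefix m = n is the endpoint condition; where it fails there are no admissible
  sets.\<close>

lemma dominating_sets_cond:
  assumes "B \<in> dominating_sets k n a"
  shows "min k (n - a) \<le> a"
proof -
  have "B \<subseteq> {..<n}" "card B = a" "min k (card ({..<n} - B)) \<le> card ({..<n} \<inter> B)"
    using assms by (auto simp: dominating_sets_def)
  moreover have "{..<n} \<inter> B = B" "card ({..<n} - B) = n - card B"
    using \<open>B \<subseteq> {..<n}\<close> by (auto simp: card_Diff_subset finite_subset)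
  ultimately show ?thesis by simp
qed

text \<open>Splits on the last step, at position n. Lengthening the path adds the single prefix m =
  n + 1, whose condition concerns only the endpoint and is granted by the second assumption, so both
  kinds of predecessor are taken in full.\<close>

lemma dominating_sets_Suc:
  assumes "a \<le> n" "min k (n - a) \<le> Suc a"
  shows "dominating_sets k (Suc n) (Suc a)
       = insert n ` dominating_sets k n a \<union> dominating_sets k n (Suc a)"
proof -
  have *: "B \<in> dominating_sets k (Suc n) (Suc a) \<longleftrightarrow> B \<in> dominating_sets k n (Suc a)"
    if "n \<notin> B" for B
  proof -
    have sub: "B \<subseteq> {..<Suc n} \<longleftrightarrow> B \<subseteq> {..<n}"
      using that by (auto simp: less_Suc_eq)
    have "min k (card ({..<Suc n} - B)) \<le> card ({..<Suc n} \<inter> B)" if "B \<subseteq> {..<n}" "card B = Suc a"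
    proof -
      have "B \<subseteq> {..<Suc n}" using that by auto
      then have "{..<Suc n} \<inter> B = B" "card ({..<Suc n} - B) = Suc n - card B"
        by (auto simp: card_Diff_subset finite_subset)
      then show ?thesis using that assms by simp
    qed
    then show ?thesis
      unfolding dominating_sets_def mem_Collect_eq sub by (auto simp: le_Suc_eq)
  qed
  have **: "insert n B \<in> dominating_sets k (Suc n) (Suc a) \<longleftrightarrow> B \<in> dominating_sets k n a"
    if "n \<notin> B" for B
  proof -
    have sub: "insert n B \<subseteq> {..<Suc n} \<longleftrightarrow> B \<subseteq> {..<n}"
      using that by (auto simp: less_Suc_eq)
    have eq: "{..<m} - insert n B = {..<m} - B" "{..<m} \<inter> insert n B = {..<m} \<inter> B" if "m \<le> n" for m
      using that by auto
    have cd: "card (insert n B) = Suc a \<longleftrightarrow> card B = a" if "B \<subseteq> {..<n}"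
      using that finite_subset[OF that] \<open>n \<notin> B\<close> by auto
    have "min k (card ({..<Suc n} - insert n B)) \<le> card ({..<Suc n} \<inter> insert n B)"
      if "B \<subseteq> {..<n}" "card B = a"
    proof -
      have fin: "finite B" using that finite_subset by blast
      have 1: "{..<Suc n} \<inter> insert n B = insert n B" "{..<Suc n} - insert n B = {..<n} - B"
        using that by (auto simp: less_Suc_eq)
      have 2: "card ({..<n} - B) = n - card B" using that fin by (simp add: card_Diff_subset)
      show ?thesis using that assms fin \<open>n \<notin> B\<close> unfolding 1 2 by simp
    qed
    then show ?thesis
      unfolding dominating_sets_def mem_Collect_eq sub using cd eq by (auto simp: le_Suc_eq)
  qed
  have no: "n \<notin> B" if "B \<in> dominating_sets k n b" for B b
    using that by (auto simp: dominating_sets_def)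
  show ?thesis
  proof (intro equalityI subsetI)
    fix B assume B: "B \<in> dominating_sets k (Suc n) (Suc a)"
    show "B \<in> insert n ` dominating_sets k n a \<union> dominating_sets k n (Suc a)"
    proof (cases "n \<in> B")
      case True
      then have "B = insert n (B - {n})" by auto
      then show ?thesis using **[of "B - {n}"] B by (metis Diff_iff UnI1 image_eqI singletonI)
    next
      case False
      then show ?thesis using * B by auto
    qed
  qed (use * ** no in auto)
qed

text \<open>For a < min k b both sides vanish. Everywhere else the correction term of
  \<open>dominating_count_Suc_Suc\<close> is absent, so both sides follow Pascal's
  recursion.\<close>

lemma card_dominating_sets:
  assumes "0 < k"
  shows "int (card (dominating_sets k (a + b) a)) = dominating_count k a b"
proof (induction "a + b" arbitrary: a b rule: less_induct)
  case less
  show ?case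
  proof (cases "a < min k b")
    case True
    then have "dominating_sets k (a + b) a = {}"
      using dominating_sets_cond[of _ k "a + b" a] by fastforce
    then show ?thesis
      using dominating_count_boundary[OF assms, of a b] True by simp
  next
    case False
    show ?thesis
    proof (cases "a = 0 \<or> b = 0")
      case True
      \<comment> \<open>If a = 0 then min k b = 0, and k > 0 forces b = 0.\<close>
      then have b: "b = 0" using False assms by auto
      have "dominating_sets k (a + b) a = {{..<a}}"
      proof -
        have "B = {..<a}" if "B \<subseteq> {..<a}" "card B = a" for B
          using that by (intro card_subset_eq) auto
        moreover have "{..<m} - {..<a} = {}" if "m \<le> a" for m using that by auto
        ultimately show ?thesis by (auto simp: dominating_sets_def b)
      qed
      then show ?thesis by (simp add: b dominating_count_0_right)
    next
      case nz: False
      then obtain a' b' where ab: "a = Suc a'" "b = Suc b'" by (meson not0_implies_Suc)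
      let ?n = "a' + b"
      have "dominating_sets k (a + b) a
          = insert ?n ` dominating_sets k ?n a' \<union> dominating_sets k ?n a"
      proof -
        have "min k (?n - a') \<le> Suc a'" using False by (auto simp: ab min_def split: if_splits)
        then show ?thesis using dominating_sets_Suc[of a' ?n k] by (simp add: ab)
      qed
      moreover have no: "?n \<notin> B" if "B \<in> dominating_sets k ?n c" for B c
        using that by (auto simp: dominating_sets_def)
      moreover have "inj_on (insert ?n) (dominating_sets k ?n a')"
        using no by (meson inj_onI insert_ident)
      moreover have "insert ?n ` dominating_sets k ?n a' \<inter> dominating_sets k ?n a = {}"
        using no by auto
      ultimately have "card (dominating_sets k (a + b) a)
         = card (dominating_sets k ?n a') + card (dominating_sets k ?n a)"
        by (simp add: card_Un_disjoint finite_dominating_sets card_image)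
      moreover have "?n = a + b'" by (simp add: ab)
      ultimately show ?thesis
        using less[of a' b] less[of a b'] dominating_count_Suc_Suc[of k a' b'] False
        by (auto simp: ab)
    qed
  qed
qed

section \<open>Copulas of random vectors\<close>

text \<open>One pi-lambda argument behind both definite descriptions of measures. Each E i contains
  the whole factor, so the whole product is itself a box and the constant sequence exhausts
  it.\<close>

lemma measure_eqI_PiM_generator:
  assumes I: "finite I"
    and E: "\<And>i. i \<in> I \<Longrightarrow> E i \<subseteq> Pow (space (M i))" "\<And>i. i \<in> I \<Longrightarrow> space (M i) \<in> E i"
      "\<And>i. i \<in> I \<Longrightarrow> Int_stable (E i)"
    and gen: "\<And>i. i \<in> I \<Longrightarrow> sets (M i) = sigma_sets (space (M i)) (E i)"
    and P: "sets P = sets (PiM I M)" and Q: "sets Q = sets (PiM I M)"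
    and fin: "finite_measure P"
    and eq: "\<And>A. (\<And>i. i \<in> I \<Longrightarrow> A i \<in> E i) \<Longrightarrow> emeasure P (PiE I A) = emeasure Q (PiE I A)"
  shows "P = Q"
proof -
  let ?G = "{PiE I A | A. \<forall>i\<in>I. A i \<in> E i}"
  let ?\<Omega> = "\<Pi>\<^sub>E i\<in>I. space (M i)"
  \<comment> \<open>\<open>sets_PiM_sigma\<close> phrases its generator through cylinders; with the
    single index block I these are the boxes.\<close>
  have G: "{{f \<in> ?\<Omega>. \<forall>i\<in>j. f i \<in> A i} | A j. j \<in> {I} \<and> A \<in> Pi j E} = ?G"
  proof -
    have *: "{f \<in> ?\<Omega>. \<forall>i\<in>I. f i \<in> A i} = PiE I A" if "\<forall>i\<in>I. A i \<in> E i" for A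
    proof -
      have "A i \<subseteq> space (M i)" if "i \<in> I" for i using E(1) that \<open>\<forall>i\<in>I. A i \<in> E i\<close> by blast
      then show ?thesis by (auto simp: PiE_iff extensional_def)
    qed
    have "{{f \<in> ?\<Omega>. \<forall>i\<in>j. f i \<in> A i} | A j. j \<in> {I} \<and> A \<in> Pi j E}
        = (\<lambda>A. {f \<in> ?\<Omega>. \<forall>i\<in>I. f i \<in> A i}) ` {A. \<forall>i\<in>I. A i \<in> E i}"
      by (auto simp: Pi_iff)
    also have "\<dots> = PiE I ` {A. \<forall>i\<in>I. A i \<in> E i}"
      by (intro image_cong refl *) simp
    finally show ?thesis by auto
  qed
  have sets: "sets (PiM I M) = sigma_sets ?\<Omega> ?G"
  proof -
    have "sets (PiM I M) = sets (\<Pi>\<^sub>M i\<in>I. sigma (space (M i)) (E i))"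
      using E(1) gen by (intro sets_PiM_cong) auto
    also have "\<dots> = sets (sigma ?\<Omega> {{f \<in> ?\<Omega>. \<forall>i\<in>j. f i \<in> A i} | A j. j \<in> {I} \<and> A \<in> Pi j E})"
    proof (rule sets_PiM_sigma)
      fix i assume "i \<in> I"
      then show "\<exists>S\<subseteq>E i. countable S \<and> space (M i) = \<Union> S"
        using E(2) by (intro exI[of _ "{space (M i)}"]) auto
    qed (use I E in auto)
    also have "\<dots> = sigma_sets ?\<Omega> ?G"
      unfolding G using E(1) by (subst sets_measure_of) (auto simp: PiE_iff; blast)+
    finally show ?thesis .
  qed
  show ?thesis
  proof (rule measure_eqI_generator_eq[where E = ?G and \<Omega> = ?\<Omega> and A = "\<lambda>_. ?\<Omega>"])
    show "Int_stable ?G"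
    proof (rule Int_stableI)
      fix a b assume "a \<in> ?G" "b \<in> ?G"
      then obtain A B where AB: "a = PiE I A" "b = PiE I B" "\<forall>i\<in>I. A i \<in> E i" "\<forall>i\<in>I. B i \<in> E i"
        by auto
      then have "a \<inter> b = PiE I (\<lambda>i. A i \<inter> B i)" by (simp add: PiE_Int)
      moreover have "\<forall>i\<in>I. A i \<inter> B i \<in> E i"
        using AB E(3) by (auto simp: Int_stable_def)
      ultimately show "a \<inter> b \<in> ?G" by auto
    qed
    show "?G \<subseteq> Pow ?\<Omega>" using E(1) by (auto simp: PiE_iff; blast)
    show "range (\<lambda>_::nat. ?\<Omega>) \<subseteq> ?G" using E(2) by auto
    show "emeasure P X = emeasure Q X" if "X \<in> ?G" for X using that eq by auto
    show "emeasure P ?\<Omega> \<noteq> \<infinity>" using fin by (simp add: finite_measure.emeasure_finite)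
  qed (use sets P Q in auto)
qed

lemma Int_stable_atMost: "Int_stable (range (atMost :: 'a::linorder \<Rightarrow> 'a set))"
proof (rule Int_stableI)
  fix a b :: "'a set" assume "a \<in> range atMost" "b \<in> range atMost"
  then obtain x y where "a = {..x}" "b = {..y}" by auto
  then have "a \<inter> b = {..min x y}" by auto
  then show "a \<inter> b \<in> range atMost" by auto
qed

lemma sets_borel_atMost:
  "sets (borel :: 'a::{linorder_topology, second_countable_topology} measure) = sigma_sets UNIV (range atMost)"
proof -
  have "sets (borel :: 'a measure) = sigma_sets UNIV (range greaterThan)"
    by (simp add: borel_Ioi)
  also have "\<dots> = sigma_sets UNIV (range atMost)"
  proof (rule sigma_sets_eqI)
    fix a :: "'a set" assume "a \<in> range greaterThan"
    then obtain x where "a = UNIV - {..x}" by (auto simp: Compl_eq_Diff_UNIV[symmetric])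
    then show "a \<in> sigma_sets UNIV (range atMost)" by (auto intro: sigma_sets.Compl)
  next
    fix a :: "'a set" assume "a \<in> range atMost"
    then obtain x where "a = UNIV - {x<..}" by (auto simp: Compl_eq_Diff_UNIV[symmetric])
    then show "a \<in> sigma_sets UNIV (range greaterThan)" by (auto intro: sigma_sets.Compl)
  qed
  finally show ?thesis .
qed

text \<open>Uniqueness for \<open>df_measure\<close>. Over the extended reals the ray up to infinity
  is the whole line, so lower orthants already form a generator containing the space.\<close>

lemma measure_eqI_ereal_vecs:
  assumes "sets P = sets (ereal_vecs d)" "sets Q = sets (ereal_vecs d)"
    "prob_space P" "prob_space Q"
    "\<And>x. x \<in> space (ereal_vecs d) \<Longrightarrow>
      measure P (\<Pi>\<^sub>E i\<in>{1..d}. {..x i}) = measure Q (\<Pi>\<^sub>E i\<in>{1..d}. {..x i})"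
  shows "P = Q"
proof (rule measure_eqI_PiM_generator[where M = "\<lambda>_. borel" and E = "\<lambda>_. range atMost"])
  interpret P: prob_space P by fact
  interpret Q: prob_space Q by fact
  show "finite_measure P" by (rule P.finite_measure_axioms)
  show "space borel \<in> range (atMost :: ereal \<Rightarrow> _)"
    by (auto intro!: image_eqI[of _ _ \<infinity>])
  show "emeasure P (PiE {1..d} A) = emeasure Q (PiE {1..d} A)" if A: "\<And>i. i \<in> {1..d} \<Longrightarrow> A i \<in> range atMost" for A
  proof -
    have "\<exists>x. \<forall>i\<in>{1..d}. A i = {..x i}" by (intro bchoice ballI) (metis A rangeE)
    then obtain x where x: "\<forall>i\<in>{1..d}. A i = {..x i}" by blast
    let ?x = "restrict x {1..d}"
    have "PiE {1..d} A = (\<Pi>\<^sub>E i\<in>{1..d}. {..?x i})" using x by (intro PiE_cong) auto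
    moreover have "?x \<in> space (ereal_vecs d)" by (auto simp: space_PiM)
    ultimately show ?thesis
      using assms(5)[of ?x] by (simp add: P.emeasure_eq_measure Q.emeasure_eq_measure)
  qed
qed (use assms Int_stable_atMost in \<open>auto simp: sets_borel_atMost\<close>)

text \<open>Uniqueness for \<open>copula_measure\<close>, with the traces of the rays {..x} on [0,1]
  as sides.\<close>

lemma measure_eqI_unit_cube:
  assumes "sets P = sets (\<Pi>\<^sub>M i\<in>{1..n}. restrict_space borel {0..1::real})"
    "sets Q = sets (\<Pi>\<^sub>M i\<in>{1..n}. restrict_space borel {0..1::real})"
    "prob_space P" "prob_space Q"
    "\<And>u. u \<in> cube n \<Longrightarrow>
      measure P (\<Pi>\<^sub>E i\<in>{1..n}. {0..u i}) = measure Q (\<Pi>\<^sub>E i\<in>{1..n}. {0..u i})"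
  shows "P = Q"
proof (rule measure_eqI_PiM_generator[where M = "\<lambda>_. restrict_space borel {0..1::real}"
      and E = "\<lambda>_. (\<inter>) {0..1} ` range atMost"])
  interpret P: prob_space P by fact
  interpret Q: prob_space Q by fact
  show "finite_measure P" by (rule P.finite_measure_axioms)
  have sp: "space (restrict_space borel {0..1::real}) = {0..1}" by (simp add: space_restrict_space)
  show "space (restrict_space borel {0..1::real}) \<in> (\<inter>) {0..1} ` range atMost"
    unfolding sp by (auto intro!: image_eqI[of _ _ "{..1}"])
  show "(\<inter>) {0..1} ` range atMost \<subseteq> Pow (space (restrict_space borel {0..1::real}))"
    by (auto simp: sp)
  show "Int_stable ((\<inter>) {0..1::real} ` range atMost)"
  proof (rule Int_stableI)
    fix a b assume "a \<in> (\<inter>) {0..1::real} ` range atMost" "b \<in> (\<inter>) {0..1::real} ` range atMost"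
    then obtain x y where "a = {0..1} \<inter> {..x}" "b = {0..1} \<inter> {..y}" by blast
    then have "a \<inter> b = {0..1} \<inter> {..min x y}" by auto
    then show "a \<inter> b \<in> (\<inter>) {0..1} ` range atMost" by (simp only: imageI rangeI)
  qed
  show "sets (restrict_space borel {0..1::real})
      = sigma_sets (space (restrict_space borel {0..1::real})) ((\<inter>) {0..1} ` range atMost)"
    unfolding sp sets_restrict_space sets_borel_atMost
  proof (rule sigma_sets_Int)
    show "{0..1::real} \<in> sigma_sets UNIV (range atMost)"
      unfolding sets_borel_atMost[symmetric] by simp
  qed simp
  show "emeasure P (PiE {1..n} A) = emeasure Q (PiE {1..n} A)"
    if A: "\<And>i. i \<in> {1..n} \<Longrightarrow> A i \<in> (\<inter>) {0..1} ` range atMost" for A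
  proof (cases "PiE {1..n} A = {}")
    case False
    have "\<exists>x. \<forall>i\<in>{1..n}. A i = {0..1} \<inter> {..x i}" by (intro bchoice ballI) (metis A imageE)
    then obtain x where x: "\<forall>i\<in>{1..n}. A i = {0..1} \<inter> {..x i}" by blast
    \<comment> \<open>Bounds above 1 are lowered to 1 without changing the box, and its nonemptiness
      excludes negative ones, so \<open>?u\<close> is a point of the cube.\<close>
    let ?u = "\<lambda>i\<in>{1..n}. min (x i) 1"
    have "A i \<noteq> {}" if "i \<in> {1..n}" for i using False that by (auto simp: PiE_eq_empty_iff)
    then have "0 \<le> x i" if "i \<in> {1..n}" for i using x that by fastforce
    then have "?u \<in> cube n" by (auto simp: cube_def)
    moreover have "PiE {1..n} A = (\<Pi>\<^sub>E i\<in>{1..n}. {0..?u i})" using x by (intro PiE_cong) auto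
    ultimately show ?thesis
      using assms(5)[of ?u] by (simp add: P.emeasure_eq_measure Q.emeasure_eq_measure)
  qed simp
qed (use assms in auto)

section \<open>Copula, copula measure and bracket expressed by a random vector\<close>

lemma copula_of_random_vector:
  assumes "prob_space P"
    and V[measurable]: "\<And>i. i \<in> {1..n} \<Longrightarrow> V i \<in> borel_measurable P"
    and unif: "\<And>i t. i \<in> {1..n} \<Longrightarrow> t \<in> {0..1} \<Longrightarrow> measure P {y\<in>space P. V i y \<le> t} = t"
  shows "copula n (\<lambda>u\<in>cube n. measure P {y\<in>space P. \<forall>i\<in>{1..n}. V i y \<le> u i})"
    (is "copula n ?C")
proof -
  interpret prob_space P by fact
  show ?thesis
    unfolding copula_def
  proof (intro conjI ballI impI)
    show "?C \<in> cube n \<rightarrow>\<^sub>E {0..1}" by auto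
  next
    fix a b assume ab: "a \<in> cube n" "b \<in> cube n" "\<forall>i\<in>{1..n}. a i \<le> b i"
    define c where "c J = (\<lambda>i\<in>{1..n}. if i \<in> J then a i else b i)" for J
    have c: "c J \<in> cube n" for J using ab by (auto simp: c_def cube_def PiE_iff)
    define f where "f u i y = (indicator {..u} (V i y) :: real)" for u i y
    have [measurable]: "f u i \<in> borel_measurable P" if "i \<in> {1..n}" for u i
      using that unfolding f_def by measurable
    have C: "?C (c J) = (\<integral>y. (\<Prod>i\<in>J. f (a i) i y) * (\<Prod>i\<in>{1..n}-J. f (b i) i y) \<partial>P)"
      and int: "integrable P (\<lambda>y. (\<Prod>i\<in>J. f (a i) i y) * (\<Prod>i\<in>{1..n}-J. f (b i) i y))"
      if J: "J \<in> Pow {1..n}" for J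
    proof -
      have fin: "finite J" using J finite_subset by auto
      have ind: "(\<Prod>i\<in>J. f (a i) i y) * (\<Prod>i\<in>{1..n}-J. f (b i) i y)
          = indicator {y\<in>space P. \<forall>i\<in>{1..n}. V i y \<le> c J i} y" if "y \<in> space P" for y
      proof -
        have "(\<Prod>i\<in>J. f (a i) i y) * (\<Prod>i\<in>{1..n}-J. f (b i) i y)
            = (\<Prod>i\<in>J. f (c J i) i y) * (\<Prod>i\<in>{1..n}-J. f (c J i) i y)"
          using J by (intro arg_cong2[where f = "(*)"] prod.cong) (auto simp: c_def)
        also have "\<dots> = (\<Prod>i\<in>{1..n}. f (c J i) i y)"
          using J prod.subset_diff[of J "{1..n}" "\<lambda>i. f (c J i) i y"] by (simp add: mult.commute)
        also have "\<dots> = indicator {y\<in>space P. \<forall>i\<in>{1..n}. V i y \<le> c J i} y"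
          using that by (auto simp: f_def indicator_def)
        finally show ?thesis .
      qed
      have "integrable P (\<lambda>y. indicator {y\<in>space P. \<forall>i\<in>{1..n}. V i y \<le> c J i} y :: real)"
        by (intro integrable_real_indicator) (auto simp: emeasure_eq_measure)
      then show "integrable P (\<lambda>y. (\<Prod>i\<in>J. f (a i) i y) * (\<Prod>i\<in>{1..n}-J. f (b i) i y))"
        by (rule Bochner_Integration.integrable_cong[THEN iffD1, rotated 2]) (use ind in auto)
      have "(\<integral>y. (\<Prod>i\<in>J. f (a i) i y) * (\<Prod>i\<in>{1..n}-J. f (b i) i y) \<partial>P)
         = (\<integral>y. indicator {y\<in>space P. \<forall>i\<in>{1..n}. V i y \<le> c J i} y \<partial>P)"
        by (intro Bochner_Integration.integral_cong ind) auto
      then show "?C (c J) = (\<integral>y. (\<Prod>i\<in>J. f (a i) i y) * (\<Prod>i\<in>{1..n}-J. f (b i) i y) \<partial>P)"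
        using c by (simp add: Int_def conj_commute)
    qed
    \<comment> \<open>The alternating sum is the expectation of a product of differences of
      indicators of V i <= b i and V i <= a i. Each difference is nonnegative since a <= b.\<close>
    have "0 \<le> (\<integral>y. (\<Prod>i\<in>{1..n}. f (b i) i y - f (a i) i y) \<partial>P)"
      using ab by (intro integral_nonneg_AE AE_I2 prod_nonneg) (fastforce simp: f_def indicator_def)
    also have "\<dots> = (\<integral>y. (\<Sum>J\<in>Pow {1..n}. (-1) ^ card J *
        ((\<Prod>i\<in>J. f (a i) i y) * (\<Prod>i\<in>{1..n}-J. f (b i) i y))) \<partial>P)"
      by (subst prod_diff_conv_sum) (auto simp: mult.assoc)
    also have "\<dots> = (\<Sum>J\<in>Pow {1..n}. (-1) ^ card J * ?C (c J))"
    proof -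
      have "(\<integral>y. (\<Sum>J\<in>Pow {1..n}. (-1) ^ card J *
        ((\<Prod>i\<in>J. f (a i) i y) * (\<Prod>i\<in>{1..n}-J. f (b i) i y))) \<partial>P)
        = (\<Sum>J\<in>Pow {1..n}. \<integral>y. (-1) ^ card J *
        ((\<Prod>i\<in>J. f (a i) i y) * (\<Prod>i\<in>{1..n}-J. f (b i) i y)) \<partial>P)"
        using int by (intro Bochner_Integration.integral_sum integrable_mult_right) blast
      also have "\<dots> = (\<Sum>J\<in>Pow {1..n}. (-1) ^ card J * ?C (c J))"
        by (intro sum.cong refl) (simp only: integral_mult_right_zero C)
      finally show ?thesis .
    qed
    finally show "0 \<le> (\<Sum>J\<in>Pow {1..n}. (-1) ^ card J * ?C (\<lambda>i\<in>{1..n}. if i \<in> J then a i else b i))"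
      unfolding c_def .
  next
    fix u assume u: "u \<in> cube n" "\<exists>i\<in>{1..n}. u i = 0"
    then obtain i where i: "i \<in> {1..n}" "u i = 0" by auto
    have "measure P {y\<in>space P. \<forall>i\<in>{1..n}. V i y \<le> u i} \<le> measure P {y\<in>space P. V i y \<le> 0}"
      using i by (intro finite_measure_mono) (auto dest!: bspec[where x = i])
    then show "?C u = 0" using u(1) unif[OF i(1), of 0] by (simp add: measure_le_0_iff)
  next
    fix k t assume k: "k \<in> {1..n}" and t: "t \<in> {0..1::real}"
    let ?u = "\<lambda>i\<in>{1..n}. if i = k then t else 1"
    \<comment> \<open>The values of V are not assumed to lie in [0,1]; uniformity at t = 1 bounds
      them by 1 almost surely, which frees the other coordinates.\<close>
    have "AE y in P. \<forall>i\<in>{1..n}. V i y \<le> 1"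
      using unif[where t = 1] by (intro AE_finite_allI) (auto simp: prob_Collect_eq_1)
    then have "measure P {y\<in>space P. \<forall>i\<in>{1..n}. V i y \<le> ?u i} = measure P {y\<in>space P. V k y \<le> t}"
      using k by (intro measure_eq_AE) (auto elim!: eventually_mono)
    moreover have "?u \<in> cube n" using t by (auto simp: cube_def)
    ultimately show "?C ?u = t" using unif[OF k t] by simp
  qed
qed

text \<open>The law of V has the required box probabilities and \<open>measure_eqI_unit_cube\<close>
  makes it the only candidate. The range condition is pointwise so that V maps into the product of
  restricted spaces.\<close>

lemma copula_measure_of_random_vector:
  assumes "prob_space P"
    and V[measurable]: "\<And>i. i \<in> {1..n} \<Longrightarrow> V i \<in> borel_measurable P"
    and range: "\<And>i y. i \<in> {1..n} \<Longrightarrow> y \<in> space P \<Longrightarrow> V i y \<in> {0..1}"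
  shows "copula_measure n (\<lambda>u\<in>cube n. measure P {y\<in>space P. \<forall>i\<in>{1..n}. V i y \<le> u i})
    = distr P (\<Pi>\<^sub>M i\<in>{1..n}. restrict_space borel {0..1}) (\<lambda>y. \<lambda>i\<in>{1..n}. V i y)"
proof -
  interpret prob_space P by fact
  let ?N = "\<Pi>\<^sub>M i\<in>{1..n}. restrict_space borel {0..1::real}"
  have meas[measurable]: "(\<lambda>y. \<lambda>i\<in>{1..n}. V i y) \<in> measurable P ?N"
    using range by (intro measurable_restrict measurable_restrict_space2 V) auto
  have ps: "prob_space (distr P ?N (\<lambda>y. \<lambda>i\<in>{1..n}. V i y))"
    by (rule prob_space_distr) measurable
  have box: "(\<Pi>\<^sub>E i\<in>{1..n}. {0..u i}) \<in> sets ?N" if "u \<in> cube n" for u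
  proof (rule sets_PiM_I_finite)
    fix i assume "i \<in> {1..n}"
    then have "{0..u i} \<subseteq> {0..1}" using that by (auto simp: cube_def PiE_iff)
    then show "{0..u i} \<in> sets (restrict_space borel {0..1})"
      by (auto simp: sets_restrict_space_iff)
  qed auto
  have val: "measure (distr P ?N (\<lambda>y. \<lambda>i\<in>{1..n}. V i y)) (\<Pi>\<^sub>E i\<in>{1..n}. {0..u i})
     = measure P {y\<in>space P. \<forall>i\<in>{1..n}. V i y \<le> u i}" if u: "u \<in> cube n" for u
  proof -
    have "(\<lambda>y. \<lambda>i\<in>{1..n}. V i y) -` (\<Pi>\<^sub>E i\<in>{1..n}. {0..u i}) \<inter> space P
        = {y\<in>space P. \<forall>i\<in>{1..n}. V i y \<le> u i}"
      using range by (auto simp: PiE_iff simp del: One_nat_def)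
    then show ?thesis
      by (subst measure_distr[OF meas box[OF u]]) simp
  qed
  show ?thesis
    unfolding copula_measure_def
    by (rule the_equality) (use ps val in \<open>auto intro!: measure_eqI_unit_cube\<close>)
qed

text \<open>Change of variables under the law of V: the bracket is the chance that an independent
  copy of V is dominated by V in every coordinate.\<close>

lemma bracket_of_random_vector:
  assumes "prob_space P"
    and V[measurable]: "\<And>i. i \<in> {1..n} \<Longrightarrow> V i \<in> borel_measurable P"
    and range: "\<And>i y. i \<in> {1..n} \<Longrightarrow> y \<in> space P \<Longrightarrow> V i y \<in> {0..1}"
  defines "C \<equiv> (\<lambda>u\<in>cube n. measure P {y\<in>space P. \<forall>i\<in>{1..n}. V i y \<le> u i})"
  shows "bracket n C C = (\<integral>x. measure P {y\<in>space P. \<forall>i\<in>{1..n}. V i y \<le> V i x} \<partial>P)"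
proof -
  interpret prob_space P by fact
  let ?N = "\<Pi>\<^sub>M i\<in>{1..n}. restrict_space borel {0..1::real}"
  have meas[measurable]: "(\<lambda>y. \<lambda>i\<in>{1..n}. V i y) \<in> measurable P ?N"
    using range by (intro measurable_restrict measurable_restrict_space2 V) auto
  have sp: "space ?N = cube n" by (simp add: space_PiM cube_def space_restrict_space)
  have comp[measurable]: "(\<lambda>u. u i) \<in> borel_measurable ?N" if "i \<in> {1..n}" for i
    using measurable_component_singleton[OF that, of "\<lambda>_. restrict_space borel {0..1::real}"]
    by (simp add: measurable_restrict_space2_iff)
  have "(\<lambda>u. emeasure P {y\<in>space P. \<forall>i\<in>{1..n}. V i y \<le> u i}) \<in> borel_measurable ?N"
    by measurable
  then have "(\<lambda>u. measure P {y\<in>space P. \<forall>i\<in>{1..n}. V i y \<le> u i}) \<in> borel_measurable ?N"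
    unfolding measure_def by measurable
  then have "C \<in> borel_measurable ?N"
    by (rule measurable_cong[THEN iffD1, rotated]) (simp add: C_def sp del: One_nat_def)
  then have "bracket n C C = (\<integral>x. C (\<lambda>i\<in>{1..n}. V i x) \<partial>P)"
    using copula_measure_of_random_vector[of P n V, OF assms(1-3), folded C_def]
    by (simp add: bracket_def integral_distr[OF meas] del: One_nat_def)
  also have "\<dots> = (\<integral>x. measure P {y\<in>space P. \<forall>i\<in>{1..n}. V i y \<le> V i x} \<partial>P)"
    using range by (intro Bochner_Integration.integral_cong) (auto simp: C_def cube_def)
  finally show ?thesis .
qed

section \<open>Order statistics of uniform samples\<close>

declare One_nat_def [simp del]

definition unif :: "ereal measure" where
  "unif = distr (uniform_measure lborel {0..1}) borel ereal"

lemma sets_unif[measurable_cong, simp]: "sets unif = sets borel"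
  and space_unif[simp]: "space unif = UNIV"
  by (auto simp: unif_def)

lemma prob_space_unif: "prob_space unif"
  unfolding unif_def by (intro prob_space.prob_space_distr prob_space_uniform_measure) auto

lemma measure_unif: "A \<in> sets borel \<Longrightarrow> measure unif A = measure lborel ({0..1} \<inter> ereal -` A)"
proof -
  assume A: "A \<in> sets borel"
  have B: "ereal -` A \<in> sets borel"
    using A by (intro measurable_sets_borel[OF _ A]) auto
  have "measure unif A = measure (uniform_measure lborel {0..1}) (ereal -` A)"
    unfolding unif_def using A by (subst measure_distr) auto
  also have "\<dots> = measure lborel ({0..1} \<inter> ereal -` A)"
    using B by (subst measure_uniform_measure) auto
  finally show ?thesis .
qed

text \<open>This is literally the clamp h that \<open>copula_df\<close> applies to each coordinate,
  so the product copula yields a product measure.\<close>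

lemma measure_unif_atMost: "measure unif {..x} = real_of_ereal (max 0 (min x 1))"
proof -
  have "measure lborel ({0..1} \<inter> ereal -` {..x}) = real_of_ereal (max 0 (min x 1))"
  proof (cases x)
    case (real r)
    have "{0..1} \<inter> ereal -` {..x} = (if r < 0 then {} else {0..min r 1})"
      by (auto simp: real)
    then show ?thesis by (auto simp: real max_def min_def simp flip: zero_ereal_def)
  next
    case PInf
    then have "{0..1} \<inter> ereal -` {..x} = {0..1}" by auto
    then show ?thesis using PInf by (simp add: min_def)
  next
    case MInf
    then have "{0..1} \<inter> ereal -` {..x} = {}" by auto
    then show ?thesis using MInf by (simp add: max_def min_def)
  qed
  then show ?thesis by (simp add: measure_unif)
qed

lemma measure_unif_greaterThanAtMost:
  assumes "0 \<le> s" "s \<le> t" "t \<le> 1"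
  shows "measure unif {ereal s<..ereal t} = t - s"
proof -
  have "{0..1} \<inter> ereal -` {ereal s<..ereal t} = {s<..t}" using assms by auto
  then show ?thesis using assms by (simp add: measure_unif)
qed

lemma AE_unif_neq: "AE x in unif. x \<noteq> a"
proof -
  have "AE x in lborel. x \<noteq> real_of_ereal a"
    by (rule AE_lborel_singleton)
  then show ?thesis
    unfolding unif_def
    by (subst AE_distr_iff) (auto intro!: AE_uniform_measureI elim!: eventually_mono)
qed

lemma AE_unif_range: "AE x in unif. 0 \<le> x \<and> x \<le> 1"
  unfolding unif_def by (subst AE_distr_iff) (auto intro!: AE_uniform_measureI)

text \<open>The index set stays free because two samples of size d are later glued into one of size
  2d.\<close>

definition iid :: "nat set \<Rightarrow> (nat \<Rightarrow> ereal) measure" where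
  "iid I = (\<Pi>\<^sub>M i\<in>I. unif)"

lemma sets_iid[measurable_cong]: "sets (iid I) = sets (\<Pi>\<^sub>M i\<in>I. borel)"
  unfolding iid_def by (intro sets_PiM_cong) auto

lemma space_iid: "space (iid I) = (\<Pi>\<^sub>E i\<in>I. UNIV)"
  by (simp add: iid_def space_PiM)

lemma measurable_iid_component[measurable]: "i \<in> I \<Longrightarrow> (\<lambda>y. y i) \<in> borel_measurable (iid I)"
  using measurable_component_singleton[of i I "\<lambda>_. borel"]
  by (simp add: measurable_cong_sets[OF sets_iid refl])

lemma prob_space_iid: "prob_space (iid I)"
  unfolding iid_def by (intro prob_space_PiM prob_space_unif)

lemma product_sigma_finite_unif: "product_sigma_finite (\<lambda>_::nat. unif)"
  by (simp add: product_sigma_finite_def prob_space_imp_sigma_finite prob_space_unif)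

lemma measure_iid_PiE:
  assumes "finite I" "\<And>i. i \<in> I \<Longrightarrow> A i \<in> sets borel"
  shows "measure (iid I) (PiE I A) = (\<Prod>i\<in>I. measure unif (A i))"
proof -
  interpret unif: prob_space unif by (rule prob_space_unif)
  interpret prob_space "iid I" by (rule prob_space_iid)
  have "emeasure (iid I) (PiE I A) = (\<Prod>i\<in>I. emeasure unif (A i))"
    unfolding iid_def using assms
    by (intro product_sigma_finite.emeasure_PiM product_sigma_finite_unif) auto
  then show ?thesis
    by (simp add: emeasure_eq_measure unif.emeasure_eq_measure prod_ennreal prod_nonneg)
qed

lemma measure_iid_component:
  assumes "i \<in> I" "A \<in> sets borel"
  shows "measure (iid I) {y\<in>space (iid I). y i \<in> A} = measure unif A"
proof -
  have "measure unif A = measure (distr (iid I) unif (\<lambda>y. y i)) A"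
    unfolding iid_def by (subst distr_PiM_component) (auto simp: assms prob_space_unif)
  also have "\<dots> = measure (iid I) {y\<in>space (iid I). y i \<in> A}"
    using assms by (subst measure_distr) (auto simp: iid_def vimage_def Int_def conj_commute)
  finally show ?thesis by simp
qed

lemma AE_iid_range:
  assumes "finite I"
  shows "AE y in iid I. \<forall>i\<in>I. 0 \<le> y i \<and> y i \<le> 1"
  unfolding iid_def
  by (intro AE_finite_allI assms AE_PiM_component[where P = "\<lambda>x. 0 \<le> x \<and> x \<le> 1"] prob_space_unif AE_unif_range)

text \<open>Fubini, integrating over coordinate i first: with the others fixed, the event pins it to
  a single point, a null set of \<open>unif\<close>.\<close>

lemma AE_iid_neq:
  assumes "finite I" "i \<in> I" "j \<in> I" "i \<noteq> j"
  shows "AE y in iid I. y i \<noteq> y j"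
proof -
  interpret product_sigma_finite "\<lambda>_::nat. unif" by (rule product_sigma_finite_unif)
  let ?J = "I - {i}"
  have I: "I = insert i ?J" using assms by auto
  note [measurable] = measurable_iid_component[OF assms(2)] measurable_iid_component[OF assms(3)]
  have "emeasure (iid I) {y\<in>space (iid I). y i = y j} = (\<integral>\<^sup>+y. indicator {y\<in>space (iid I). y i = y j} y \<partial>iid I)"
    by simp
  also have "\<dots> = (\<integral>\<^sup>+y. indicator {y\<in>space (iid I). y i = y j} y \<partial>PiM (insert i ?J) (\<lambda>_. unif))"
    unfolding iid_def I[symmetric] ..
  also have "\<dots> = (\<integral>\<^sup>+x. (\<integral>\<^sup>+t. indicator {y\<in>space (iid I). y i = y j} (x(i := t)) \<partial>unif) \<partial>PiM ?J (\<lambda>_. unif))"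
  proof (rule product_nn_integral_insert)
    show "indicator {y\<in>space (iid I). y i = y j} \<in> borel_measurable (PiM (insert i ?J) (\<lambda>_. unif))"
      unfolding I[symmetric] iid_def[symmetric] by measurable
  qed (use assms in auto)
  also have "\<dots> = (\<integral>\<^sup>+x. 0 \<partial>PiM ?J (\<lambda>_. unif))"
  proof (intro nn_integral_cong)
    fix x
    have "AE t in unif. indicator {y\<in>space (iid I). y i = y j} (x(i := t)) = (0::ennreal)"
      using AE_unif_neq[of "x j"] assms(4) by (auto elim!: eventually_mono simp: indicator_def)
    then show "(\<integral>\<^sup>+t. indicator {y\<in>space (iid I). y i = y j} (x(i := t)) \<partial>unif) = 0"
      by (subst nn_integral_cong_AE) auto
  qed
  finally have "emeasure (iid I) {y\<in>space (iid I). y i = y j} = 0" by simp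
  then show ?thesis by (subst AE_iff_measurable[OF _ refl]) auto
qed

lemma AE_iid_inj:
  assumes "finite I"
  shows "AE y in iid I. inj_on y I"
proof -
  have "AE y in iid I. \<forall>i\<in>I. \<forall>j\<in>I. i \<noteq> j \<longrightarrow> y i \<noteq> y j"
    using assms AE_iid_neq[OF assms] by (intro AE_finite_allI) (auto simp: AE_conj_iff)
  then show ?thesis by (auto simp: inj_on_def elim!: eventually_mono)
qed

section \<open>The sample measure and its order statistics\<close>

lemma unit_clamp: "real_of_ereal (max 0 (min x 1)) \<in> {0..1}"
  by (cases x) (auto simp: max_def min_def zero_ereal_def one_ereal_def)

lemma df_measure_product_copula:
  "df_measure d (copula_df d (product_copula d)) = iid {1..d}"
proof -
  have val: "measure (iid {1..d}) (\<Pi>\<^sub>E i\<in>{1..d}. {..x i}) = copula_df d (product_copula d) x" for x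
    using unit_clamp by (subst measure_iid_PiE)
      (auto simp: copula_df_def product_copula_def cube_def measure_unif_atMost simp del: atLeastAtMost_iff)
  show ?thesis
    unfolding df_measure_def
    by (rule the_equality) (use val prob_space_iid in \<open>auto intro!: measure_eqI_ereal_vecs simp: sets_iid\<close>)
qed

text \<open>A set J attaining the bound is an i-element subset of the coordinates that are at most
  t. This trades the min-max formula for counting.\<close>

lemma order_map_le_iff:
  assumes "i \<in> {1..d}"
  shows "order_map d x i \<le> t \<longleftrightarrow> i \<le> card {j\<in>{1..d}. x j \<le> t}"
proof -
  let ?S = "{J. J \<subseteq> {1..d} \<and> card J = i}"
  have fin: "finite ?S" by (rule finite_subset[of _ "Pow {1..d}"]) auto
  have "{1..i} \<in> ?S" using assms by auto
  then have ne: "?S \<noteq> {}" by blast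
  have "order_map d x i \<le> t \<longleftrightarrow> (\<exists>J\<in>?S. Max (x ` J) \<le> t)"
    using assms fin ne by (simp add: order_map_def Min_le_iff)
  also have "\<dots> \<longleftrightarrow> (\<exists>J\<in>?S. \<forall>j\<in>J. x j \<le> t)"
  proof (intro bex_cong refl)
    fix J assume "J \<in> ?S"
    then have "finite J" "J \<noteq> {}" using assms finite_subset[of J "{1..d}"] by auto
    then show "Max (x ` J) \<le> t \<longleftrightarrow> (\<forall>j\<in>J. x j \<le> t)" by simp
  qed
  also have "\<dots> \<longleftrightarrow> i \<le> card {j\<in>{1..d}. x j \<le> t}"
  proof
    assume "\<exists>J\<in>?S. \<forall>j\<in>J. x j \<le> t"
    then obtain J where J: "J \<subseteq> {1..d}" "card J = i" "\<forall>j\<in>J. x j \<le> t" by auto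
    then have "J \<subseteq> {j\<in>{1..d}. x j \<le> t}" by auto
    then have "card J \<le> card {j\<in>{1..d}. x j \<le> t}" by (intro card_mono) auto
    then show "i \<le> card {j\<in>{1..d}. x j \<le> t}" using J by simp
  next
    assume "i \<le> card {j\<in>{1..d}. x j \<le> t}"
    then obtain J where "J \<subseteq> {j\<in>{1..d}. x j \<le> t}" "card J = i"
      by (meson obtain_subset_with_card_n)
    then show "\<exists>J\<in>?S. \<forall>j\<in>J. x j \<le> t" by (intro bexI[of _ J]) auto
  qed
  finally show ?thesis .
qed

lemma measurable_order_map[measurable]:
  "order_map d \<in> measurable (ereal_vecs d) (ereal_vecs d)"
  unfolding order_map_def
proof (rule measurable_restrict)
  fix i assume "i \<in> {1..d}"
  have fin: "finite {J. J \<subseteq> {1..d} \<and> card J = i}"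
    by (rule finite_subset[of _ "Pow {1..d}"]) auto
  show "(\<lambda>x. Min ((\<lambda>J. Max (x ` J)) ` {J. J \<subseteq> {1..d} \<and> card J = i})) \<in> borel_measurable (ereal_vecs d)"
  proof (rule borel_measurable_Min[OF fin])
    fix J assume "J \<in> {J. J \<subseteq> {1..d} \<and> card J = i}"
    then have "finite J" "J \<subseteq> {1..d}" using finite_subset[of J "{1..d}"] by auto
    then show "(\<lambda>x. Max (x ` J)) \<in> borel_measurable (ereal_vecs d)"
      by (intro borel_measurable_Max measurable_component_singleton) auto
  qed
qed

lemma measurable_order_map_component[measurable]:
  "i \<in> {1..d} \<Longrightarrow> (\<lambda>y. order_map d y i) \<in> borel_measurable (iid {1..d})"
  using measurable_compose[OF measurable_order_map measurable_component_singleton, of i d]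
  by (simp add: measurable_cong_sets[OF sets_iid refl])

lemma order_map_range:
  assumes "i \<in> {1..d}" "\<forall>j\<in>{1..d}. 0 \<le> y j \<and> y j \<le> 1"
  shows "0 \<le> order_map d y i" "order_map d y i \<le> 1"
proof -
  have "{j\<in>{1..d}. y j \<le> 1} = {1..d}" using assms by auto
  then show "order_map d y i \<le> 1" using assms by (simp add: order_map_le_iff)
  show "0 \<le> order_map d y i"
  proof (rule ccontr)
    assume *: "\<not> 0 \<le> order_map d y i"
    have "1 \<le> card {j\<in>{1..d}. y j \<le> order_map d y i}"
      using order_map_le_iff[OF assms(1), of y "order_map d y i"] assms(1) by simp
    then obtain j where "j \<in> {1..d}" "y j \<le> order_map d y i"
      by (metis (mono_tags, lifting) card.empty empty_Collect_eq not_one_le_zero)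
    then show False using * assms by (meson order_trans)
  qed
qed

section \<open>Marginal distribution functions of the order statistics\<close>

definition os_df :: "nat \<Rightarrow> nat \<Rightarrow> ereal \<Rightarrow> real" where
  "os_df d i t = measure (iid {1..d}) {y\<in>space (iid {1..d}). order_map d y i \<le> t}"

lemma order_df_product_copula:
  "order_df d (product_copula d) x
     = measure (iid {1..d}) {y\<in>space (iid {1..d}). \<forall>i\<in>{1..d}. order_map d y i \<le> x i}"
proof -
  have [measurable]: "order_map d \<in> measurable (iid {1..d}) (ereal_vecs d)"
    using measurable_order_map by (simp add: measurable_cong_sets[OF sets_iid refl])
  have "order_map d -` (\<Pi>\<^sub>E i\<in>{1..d}. {..x i}) \<inter> space (iid {1..d})
     = {y\<in>space (iid {1..d}). \<forall>i\<in>{1..d}. order_map d y i \<le> x i}"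
    by (auto simp: PiE_iff order_map_def)
  then show ?thesis
    unfolding order_df_def df_measure_product_copula
    by (subst measure_distr) (auto intro!: sets_PiM_I_finite)
qed

lemma marginal_df_product_copula:
  assumes "i \<in> {1..d}"
  shows "marginal_df d (order_df d (product_copula d)) i t = os_df d i t"
  unfolding marginal_df_def order_df_product_copula os_df_def
  using assms by (intro arg_cong[where f = "measure (iid {1..d})"]) (auto split: if_splits)

lemma os_df_mono: "i \<in> {1..d} \<Longrightarrow> s \<le> t \<Longrightarrow> os_df d i s \<le> os_df d i t"
proof -
  interpret prob_space "iid {1..d}" by (rule prob_space_iid)
  show "i \<in> {1..d} \<Longrightarrow> s \<le> t \<Longrightarrow> os_df d i s \<le> os_df d i t"
    unfolding os_df_def by (intro finite_measure_mono) auto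
qed

lemma os_df_range: "os_df d i t \<in> {0..1}"
proof -
  interpret prob_space "iid {1..d}" by (rule prob_space_iid)
  show ?thesis by (auto simp: os_df_def)
qed

text \<open>
  The lower bound is the probability that the whole sample falls into the interval, the upper bound
  that some member does; they make the marginal distribution functions strictly increasing and
  continuous on the unit interval.
\<close>

lemma os_df_diff:
  assumes i: "i \<in> {1..d}" and st: "0 \<le> s" "s \<le> t" "t \<le> 1"
  shows "(t - s) ^ d \<le> os_df d i (ereal t) - os_df d i (ereal s)"
    and "os_df d i (ereal t) - os_df d i (ereal s) \<le> real d * (t - s)"
proof -
  interpret prob_space "iid {1..d}" by (rule prob_space_iid)
  let ?D = "{y\<in>space (iid {1..d}). order_map d y i \<le> t} - {y\<in>space (iid {1..d}). order_map d y i \<le> s}"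
  have [measurable]: "?D \<in> sets (iid {1..d})" using i by measurable
  have diff: "os_df d i (ereal t) - os_df d i (ereal s) = prob ?D"
    unfolding os_df_def using i st
    by (subst finite_measure_Diff) (auto intro: order_trans[of _ "ereal s" "ereal t"])
  have "(t - s) ^ d = prob (\<Pi>\<^sub>E j\<in>{1..d}. {ereal s<..ereal t})"
    using st by (subst measure_iid_PiE) (auto simp: measure_unif_greaterThanAtMost)
  also have "\<dots> \<le> prob ?D"
  proof (rule finite_measure_mono)
    show "(\<Pi>\<^sub>E j\<in>{1..d}. {ereal s<..ereal t}) \<subseteq> ?D"
    proof
      fix y assume y: "y \<in> (\<Pi>\<^sub>E j\<in>{1..d}. {ereal s<..ereal t})"
      then have cnt: "{j\<in>{1..d}. y j \<le> t} = {1..d}" "{j\<in>{1..d}. y j \<le> s} = {}"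
        by (auto simp: PiE_iff not_le)
      moreover have "y \<in> space (iid {1..d})" using y by (auto simp: space_iid PiE_iff)
      moreover have "order_map d y i \<le> t" "\<not> order_map d y i \<le> s"
        unfolding order_map_le_iff[OF i] cnt using i by auto
      ultimately show "y \<in> ?D" by simp
    qed
  qed fact
  finally show "(t - s) ^ d \<le> os_df d i (ereal t) - os_df d i (ereal s)" unfolding diff .
  have "prob ?D \<le> prob (\<Union>j\<in>{1..d}. {y\<in>space (iid {1..d}). y j \<in> {ereal s<..ereal t}})"
  proof (rule finite_measure_mono)
    show "?D \<subseteq> (\<Union>j\<in>{1..d}. {y\<in>space (iid {1..d}). y j \<in> {ereal s<..ereal t}})"
    proof
      fix y assume y: "y \<in> ?D"
      then have "card {j\<in>{1..d}. y j \<le> s} < card {j\<in>{1..d}. y j \<le> t}"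
        using i by (auto simp: order_map_le_iff)
      moreover have "finite {j\<in>{1..d}. y j \<le> s}" by simp
      ultimately have "\<not> {j\<in>{1..d}. y j \<le> t} \<subseteq> {j\<in>{1..d}. y j \<le> s}"
        by (meson card_mono not_le)
      then obtain j where "j \<in> {1..d}" "y j \<le> t" "\<not> y j \<le> s" by blast
      then show "y \<in> (\<Union>j\<in>{1..d}. {y\<in>space (iid {1..d}). y j \<in> {ereal s<..ereal t}})"
        using y by (auto simp: not_le)
    qed
  qed measurable
  also have "\<dots> \<le> (\<Sum>j\<in>{1..d}. prob {y\<in>space (iid {1..d}). y j \<in> {ereal s<..ereal t}})"
    by (rule finite_measure_subadditive_finite) auto
  also have "\<dots> = real d * (t - s)"
    using st by (simp add: measure_iid_component measure_unif_greaterThanAtMost del: greaterThanAtMost_iff)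
  finally show "os_df d i (ereal t) - os_df d i (ereal s) \<le> real d * (t - s)" unfolding diff .
qed

lemma os_df_ge_1:
  assumes "i \<in> {1..d}" "1 \<le> t"
  shows "os_df d i t = 1"
proof -
  interpret prob_space "iid {1..d}" by (rule prob_space_iid)
  have "AE y in iid {1..d}. order_map d y i \<le> t"
    using AE_iid_range[OF finite_atLeastAtMost]
  proof eventually_elim
    case (elim y)
    show ?case using order_map_range(2)[OF assms(1) elim] assms(2) by (rule order_trans)
  qed
  then show ?thesis unfolding os_df_def using assms by (subst prob_Collect_eq_1) auto
qed

lemma AE_order_map_pos:
  assumes "i \<in> {1..d}"
  shows "AE y in iid {1..d}. 0 < order_map d y i"
proof -
  have "AE x in unif. 0 < x"
    using AE_unif_range AE_unif_neq[of 0] by eventually_elim auto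
  then have "AE y in iid {1..d}. \<forall>j\<in>{1..d}. 0 < y j"
    unfolding iid_def
    by (intro AE_finite_allI AE_PiM_component[where P = "\<lambda>x. 0 < x"] prob_space_unif) auto
  then show ?thesis
  proof eventually_elim
    case (elim y)
    then have none: "{j\<in>{1..d}. y j \<le> 0} = {}" by (auto simp: not_le)
    have "\<not> order_map d y i \<le> 0"
      unfolding order_map_le_iff[OF assms] none using assms by simp
    then show ?case by simp
  qed
qed

lemma os_df_le_0:
  assumes "i \<in> {1..d}" "t \<le> 0"
  shows "os_df d i t = 0"
proof -
  interpret prob_space "iid {1..d}" by (rule prob_space_iid)
  have "AE y in iid {1..d}. \<not> order_map d y i \<le> t"
    using AE_order_map_pos[OF assms(1)]
  proof eventually_elim
    case (elim y)
    then show ?case using assms(2) by (meson le_less_trans not_le)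
  qed
  then show ?thesis unfolding os_df_def using assms by (subst prob_Collect_eq_0) auto
qed

text \<open>Makes \<open>os_df\<close> a monotone function of a real argument, from which
  \<open>os_uniform\<close> gets its measurability.\<close>

lemma os_df_clamp:
  assumes "i \<in> {1..d}"
  shows "os_df d i (ereal (real_of_ereal (max 0 (min t 1)))) = os_df d i t"
proof -
  consider "t \<le> 0" | "1 \<le> t" | r where "t = ereal r" "0 \<le> r" "r \<le> 1"
    by (cases t) (auto simp: zero_ereal_def one_ereal_def, metis linear)
  then show ?thesis
  proof cases
    case 1
    then have "max 0 (min t 1) = 0" by (auto simp: max_def min_def intro: order_trans[of t 0])
    then show ?thesis using os_df_le_0[OF assms] 1 by simp
  next
    case 2
    then have "max 0 (min t 1) = 1" by (auto simp: max_def min_def)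
    then show ?thesis using os_df_ge_1[OF assms] 2 by simp
  next
    case 3
    then have "max 0 (min t 1) = t" by (auto simp: max_def min_def zero_ereal_def one_ereal_def)
    then show ?thesis using 3 by simp
  qed
qed

text \<open>The lower bound (t - s)^d of \<open>os_df_diff\<close> makes the increase
  strict.\<close>

lemma os_df_le_iff:
  assumes i: "i \<in> {1..d}" and "0 \<le> s" "s \<le> 1" "0 \<le> t" "t \<le> 1"
  shows "os_df d i s \<le> os_df d i t \<longleftrightarrow> s \<le> t"
proof -
  obtain a b where ab: "s = ereal a" "t = ereal b" "0 \<le> a" "a \<le> 1" "0 \<le> b" "b \<le> 1"
    using assms by (cases s; cases t) (auto simp: zero_ereal_def one_ereal_def)
  have "os_df d i t < os_df d i s" if "b < a"
  proof -
    have "0 < (a - b) ^ d" using that by simp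
    moreover have "(a - b) ^ d \<le> os_df d i s - os_df d i t"
      using os_df_diff(1)[OF i, of b a] ab that by simp
    ultimately show ?thesis by linarith
  qed
  then show ?thesis using os_df_mono[OF i, of s t] ab by force
qed

text \<open>The upper bound of \<open>os_df_diff\<close> is a Lipschitz estimate, and the
  intermediate value theorem applies between F(0) = 0 and F(1) = 1.\<close>

lemma os_df_surj:
  assumes i: "i \<in> {1..d}" and u: "u \<in> {0..1}"
  obtains t where "0 \<le> t" "t \<le> 1" "os_df d i t = u"
proof -
  have lip: "dist (os_df d i (ereal a)) (os_df d i (ereal b)) \<le> real d * dist a b"
    if "a \<in> {0..1}" "b \<in> {0..1}" for a b
  proof -
    have *: "\<bar>os_df d i (ereal t) - os_df d i (ereal s)\<bar> \<le> real d * (t - s)"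
      if "0 \<le> s" "s \<le> t" "t \<le> 1" for s t
      using os_df_diff(2)[OF i that] os_df_mono[OF i, of "ereal s" "ereal t"] that by simp
    show ?thesis using *[of a b] *[of b a] that by (cases "a \<le> b") (auto simp: dist_real_def)
  qed
  have "(real d)-lipschitz_on {0..1} (\<lambda>t. os_df d i (ereal t))"
    by (rule lipschitz_onI) (use lip in auto)
  then have "continuous_on {0..1} (\<lambda>t. os_df d i (ereal t))"
    by (rule lipschitz_on_continuous_on)
  moreover have "os_df d i (ereal 0) = 0" "os_df d i (ereal 1) = 1"
    using os_df_le_0[OF i, of 0] os_df_ge_1[OF i, of 1] by (auto simp: zero_ereal_def one_ereal_def)
  ultimately obtain r where "0 \<le> r" "r \<le> 1" "os_df d i (ereal r) = u"
    using IVT'[of "\<lambda>t. os_df d i (ereal t)" 0 u 1] u by auto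
  then show thesis using that[of "ereal r"] by (auto simp: zero_ereal_def one_ereal_def)
qed

text \<open>The probability integral transform: each order statistic passes through its own
  distribution function, which makes the margins uniform and keeps the dependence.\<close>

definition os_uniform :: "nat \<Rightarrow> nat \<Rightarrow> (nat \<Rightarrow> ereal) \<Rightarrow> real" where
  "os_uniform d i y = os_df d i (order_map d y i)"

lemma measurable_os_uniform[measurable]:
  assumes i: "i \<in> {1..d}"
  shows "os_uniform d i \<in> borel_measurable (iid {1..d})"
proof -
  have "(\<lambda>t. os_df d i (ereal t)) \<in> borel_measurable borel"
    using os_df_mono[OF i] by (intro borel_measurable_mono monoI) auto
  then have "(\<lambda>y. os_df d i (ereal (real_of_ereal (max 0 (min (order_map d y i) 1)))))
     \<in> borel_measurable (iid {1..d})"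
    using i by measurable
  then show ?thesis unfolding os_df_clamp[OF i] os_uniform_def .
qed

lemma os_uniform_le_iff:
  assumes "i \<in> {1..d}" "\<forall>j\<in>{1..d}. 0 \<le> y j \<and> y j \<le> 1" "0 \<le> t" "t \<le> 1"
  shows "os_uniform d i y \<le> os_df d i t \<longleftrightarrow> order_map d y i \<le> t"
  unfolding os_uniform_def using assms order_map_range[of i d y] by (intro os_df_le_iff) auto

lemma os_uniform_uniform:
  assumes i: "i \<in> {1..d}" and u: "u \<in> {0..1}"
  shows "measure (iid {1..d}) {y\<in>space (iid {1..d}). os_uniform d i y \<le> u} = u"
proof -
  interpret prob_space "iid {1..d}" by (rule prob_space_iid)
  obtain t where t: "0 \<le> t" "t \<le> 1" "os_df d i t = u" using os_df_surj[OF i u] .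
  have "AE y in iid {1..d}. os_uniform d i y \<le> u \<longleftrightarrow> order_map d y i \<le> t"
    using AE_iid_range[OF finite_atLeastAtMost, of 1 d]
  proof eventually_elim
    case (elim y)
    then show ?case using os_uniform_le_iff[OF i _ t(1,2)] t(3) by simp
  qed
  then have "prob {y\<in>space (iid {1..d}). os_uniform d i y \<le> u} = os_df d i t"
    unfolding os_df_def using i by (intro measure_eq_AE) auto
  then show ?thesis using t by simp
qed

section \<open>Sklar's relation and the order transform of the product copula\<close>

definition os_copula :: "nat \<Rightarrow> (nat \<Rightarrow> real) \<Rightarrow> real" where
  "os_copula d = (\<lambda>u\<in>cube d.
     measure (iid {1..d}) {y\<in>space (iid {1..d}). \<forall>i\<in>{1..d}. os_uniform d i y \<le> u i})"

lemma copula_os_copula: "copula d (os_copula d)"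
  unfolding os_copula_def
  by (rule copula_of_random_vector) (auto simp: prob_space_iid os_uniform_uniform)

text \<open>The two events agree only almost surely. For x i <= 0 the distribution function equals
  its value at 0, so the almost sure positivity of the order statistics is what makes both
  conditions fail.\<close>

lemma order_df_os_copula:
  "order_df d (product_copula d) x = os_copula d (\<lambda>i\<in>{1..d}. os_df d i (x i))"
proof -
  interpret prob_space "iid {1..d}" by (rule prob_space_iid)
  have cube: "(\<lambda>i\<in>{1..d}. os_df d i (x i)) \<in> cube d"
    using os_df_range by (auto simp: cube_def simp del: atLeastAtMost_iff)
  have "AE y in iid {1..d}. \<forall>i\<in>{1..d}. 0 < order_map d y i"
    by (intro AE_finite_allI AE_order_map_pos) auto
  then have "AE y in iid {1..d}. \<forall>i\<in>{1..d}. order_map d y i \<le> x i \<longleftrightarrow> os_uniform d i y \<le> os_df d i (x i)"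
    using AE_iid_range[OF finite_atLeastAtMost]
  proof eventually_elim
    case (elim y)
    have y: "\<forall>j\<in>{1..d}. 0 \<le> y j \<and> y j \<le> 1" using elim(2) by simp
    show ?case
    proof
      fix i assume i: "i \<in> {1..d}"
      have pos: "0 < order_map d y i" using elim(1) i by blast
      consider "x i \<le> 0" | "1 \<le> x i" | "0 \<le> x i" "x i \<le> 1" by (meson linear)
      then show "order_map d y i \<le> x i \<longleftrightarrow> os_uniform d i y \<le> os_df d i (x i)"
      proof cases
        case 1
        then have "\<not> order_map d y i \<le> x i" using pos by (meson le_less_trans not_le)
        moreover have "os_df d i (x i) = os_df d i 0" using os_df_le_0[OF i] 1 by simp
        ultimately show ?thesis using os_uniform_le_iff[OF i y, of 0] pos by (simp add: not_le[symmetric])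
      next
        case 2
        then have "order_map d y i \<le> x i" using order_map_range(2)[OF i y] by (rule order_trans[rotated])
        then show ?thesis using os_df_ge_1[OF i 2] os_df_range[of d i] by (simp add: os_uniform_def)
      next
        case 3
        then show ?thesis using os_uniform_le_iff[OF i y] by simp
      qed
    qed
  qed
  then have "measure (iid {1..d}) {y\<in>space (iid {1..d}). \<forall>i\<in>{1..d}. order_map d y i \<le> x i}
     = measure (iid {1..d}) {y\<in>space (iid {1..d}). \<forall>i\<in>{1..d}. os_uniform d i y \<le> os_df d i (x i)}"
    by (intro measure_eq_AE) (auto elim!: eventually_mono)
  then show ?thesis
    unfolding order_df_product_copula os_copula_def using cube by simp
qed

text \<open>Sklar's relation determines D on the range of the marginal distribution functions. By
  \<open>os_df_surj\<close> that range is the whole cube, and outside the cube extensionality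
  decides.\<close>

lemma order_transform_product_copula: "order_transform d (product_copula d) = os_copula d"
  unfolding order_transform_def
proof (rule the_equality)
  have marg: "(\<lambda>i\<in>{1..d}. marginal_df d (order_df d (product_copula d)) i (x i))
     = (\<lambda>i\<in>{1..d}. os_df d i (x i))" for x
    by (auto simp: marginal_df_product_copula)
  show "copula d (os_copula d) \<and> (\<forall>x\<in>space (ereal_vecs d). order_df d (product_copula d) x
     = os_copula d (\<lambda>i\<in>{1..d}. marginal_df d (order_df d (product_copula d)) i (x i)))"
    unfolding marg using copula_os_copula order_df_os_copula by blast
  fix D assume D: "copula d D \<and> (\<forall>x\<in>space (ereal_vecs d). order_df d (product_copula d) x
     = D (\<lambda>i\<in>{1..d}. marginal_df d (order_df d (product_copula d)) i (x i)))"
  show "D = os_copula d"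
  proof
    fix u
    show "D u = os_copula d u"
    proof (cases "u \<in> cube d")
      case True
      have "\<exists>x. \<forall>i\<in>{1..d}. os_df d i (x i) = u i"
      proof (intro bchoice ballI)
        fix i assume i: "i \<in> {1..d}"
        then have "u i \<in> {0..1}" using True by (auto simp: cube_def PiE_iff)
        from os_df_surj[OF i this] show "\<exists>t. os_df d i t = u i" by metis
      qed
      then obtain x where x: "\<forall>i\<in>{1..d}. os_df d i (x i) = u i" by blast
      define x' where "x' = restrict x {1..d}"
      have x': "x' \<in> space (ereal_vecs d)" by (auto simp: space_PiM x'_def)
      have "(\<lambda>i\<in>{1..d}. os_df d i (x' i)) = u"
        using x True by (auto simp: x'_def cube_def PiE_iff extensional_def fun_eq_iff)
      then show ?thesis
        using D[THEN conjunct2, rule_format, OF x'] order_df_os_copula[of d x'] unfolding marg by simp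
    next
      case False
      then show ?thesis
        using D[THEN conjunct1] copula_os_copula[of d]
        by (auto simp: copula_def dest!: PiE_arb[of _ _ _ u])
    qed
  qed
qed

lemma product_order_margin_eq:
  assumes "k \<le> d"
  shows "product_order_margin d k = (\<lambda>v\<in>cube k.
     measure (iid {1..d}) {y\<in>space (iid {1..d}). \<forall>i\<in>{1..k}. os_uniform d i y \<le> v i})"
  unfolding order_transform_product_copula initial_margin_def
proof (rule restrict_ext)
  fix v assume v: "v \<in> cube k"
  let ?v = "\<lambda>i\<in>{1..d}. if i \<le> k then v i else 1"
  have "?v \<in> cube d" using v by (auto simp: cube_def PiE_iff)
  moreover have "(\<forall>i\<in>{1..d}. os_uniform d i y \<le> ?v i) \<longleftrightarrow> (\<forall>i\<in>{1..k}. os_uniform d i y \<le> v i)" for y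
    using assms os_df_range by (auto simp: os_uniform_def)
  ultimately show "os_copula d ?v
      = measure (iid {1..d}) {y\<in>space (iid {1..d}). \<forall>i\<in>{1..k}. os_uniform d i y \<le> v i}"
    by (simp add: os_copula_def del: One_nat_def)
qed

text \<open>Strict monotonicity cancels the probability integral transform. It is available on [0,1]
  only, so both samples are first restricted to that range almost surely.\<close>

lemma bracket_product_order_margin:
  assumes "k \<le> d"
  shows "bracket k (product_order_margin d k) (product_order_margin d k)
    = (\<integral>x. measure (iid {1..d}) {y\<in>space (iid {1..d}). \<forall>i\<in>{1..k}. order_map d y i \<le> order_map d x i} \<partial>iid {1..d})"
proof -
  interpret prob_space "iid {1..d}" by (rule prob_space_iid)
  have [measurable]: "os_uniform d i \<in> borel_measurable (iid {1..d})"
    "(\<lambda>y. order_map d y i) \<in> borel_measurable (iid {1..d})" if "i \<in> {1..k}" for i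
    using that assms by (auto intro!: measurable_os_uniform measurable_order_map_component)
  have "bracket k (product_order_margin d k) (product_order_margin d k)
    = (\<integral>x. measure (iid {1..d}) {y\<in>space (iid {1..d}). \<forall>i\<in>{1..k}. os_uniform d i y \<le> os_uniform d i x} \<partial>iid {1..d})"
    unfolding product_order_margin_eq[OF assms]
  proof (rule bracket_of_random_vector[OF prob_space_iid])
    show "os_uniform d i y \<in> {0..1}" for i y unfolding os_uniform_def by (rule os_df_range)
  qed measurable
  also have "\<dots> = (\<integral>x. measure (iid {1..d}) {y\<in>space (iid {1..d}). \<forall>i\<in>{1..k}. order_map d y i \<le> order_map d x i} \<partial>iid {1..d})"
  proof (rule integral_cong_AE)
    show "AE x in iid {1..d}. prob {y\<in>space (iid {1..d}). \<forall>i\<in>{1..k}. os_uniform d i y \<le> os_uniform d i x}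
       = prob {y\<in>space (iid {1..d}). \<forall>i\<in>{1..k}. order_map d y i \<le> order_map d x i}"
      using AE_iid_range[OF finite_atLeastAtMost]
    proof eventually_elim
      case (elim x)
      then have x: "\<forall>j\<in>{1..d}. 0 \<le> x j \<and> x j \<le> 1" by simp
      have "AE y in iid {1..d}. \<forall>i\<in>{1..k}. os_uniform d i y \<le> os_uniform d i x \<longleftrightarrow> order_map d y i \<le> order_map d x i"
        using AE_iid_range[OF finite_atLeastAtMost]
      proof eventually_elim
        case (elim y)
        then have y: "\<forall>j\<in>{1..d}. 0 \<le> y j \<and> y j \<le> 1" by simp
        show ?case
        proof
          fix i assume "i \<in> {1..k}"
          then have i: "i \<in> {1..d}" using assms by simp
          show "os_uniform d i y \<le> os_uniform d i x \<longleftrightarrow> order_map d y i \<le> order_map d x i"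
            using os_uniform_le_iff[OF i y order_map_range[OF i x]] by (simp add: os_uniform_def)
        qed
      qed
      then show ?case by (intro measure_eq_AE) (auto elim!: eventually_mono)
    qed
  qed (auto simp: measure_def)
  finally show ?thesis .
qed

section \<open>Exchangeability\<close>

text \<open>
  For disjoint A and B, the first k order statistics of z on A are at most those of z on B. Letting
  the threshold range over sample values only makes this visibly measurable.
\<close>

definition precedes :: "nat \<Rightarrow> 'i set \<Rightarrow> 'i set \<Rightarrow> ('i \<Rightarrow> 'a::linorder) \<Rightarrow> bool" where
  "precedes k A B z \<longleftrightarrow>
     (\<forall>l\<in>A \<union> B. min k (card {j\<in>B. z j \<le> z l}) \<le> card {j\<in>A. z j \<le> z l})"

text \<open>Replacing t by the largest sample value not exceeding it changes neither count; if there
  is no such value, both counts are 0.\<close>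

lemma precedes_iff:
  assumes "finite A" "finite B"
  shows "precedes k A B z \<longleftrightarrow> (\<forall>t. min k (card {j\<in>B. z j \<le> t}) \<le> card {j\<in>A. z j \<le> t})"
proof
  assume p: "precedes k A B z"
  show "\<forall>t. min k (card {j\<in>B. z j \<le> t}) \<le> card {j\<in>A. z j \<le> t}"
  proof
    fix t
    let ?S = "{l\<in>A \<union> B. z l \<le> t}"
    show "min k (card {j\<in>B. z j \<le> t}) \<le> card {j\<in>A. z j \<le> t}"
    proof (cases "?S = {}")
      case True
      then have none: "{j\<in>B. z j \<le> t} = {}" by auto
      show ?thesis unfolding none by simp
    next
      case False
      have "Max (z ` ?S) \<in> z ` ?S" using assms False by (intro Max_in) auto
      then obtain l where l: "l \<in> ?S" "Max (z ` ?S) = z l" by auto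
      have max: "z j \<le> z l" if "j \<in> ?S" for j
        using that assms l(2)[symmetric] by simp
      have eq: "{j\<in>B. z j \<le> t} = {j\<in>B. z j \<le> z l}" "{j\<in>A. z j \<le> t} = {j\<in>A. z j \<le> z l}"
        using max l(1) by (auto intro: order_trans)
      show ?thesis unfolding eq using p l(1) by (simp add: precedes_def)
    qed
  qed
qed (simp add: precedes_def)

lemma precedes_cong:
  assumes "\<And>j. j \<in> A \<union> B \<Longrightarrow> z j = z' j"
  shows "precedes k A B z \<longleftrightarrow> precedes k A B z'"
proof -
  have "{j\<in>B. z j \<le> z l} = {j\<in>B. z' j \<le> z' l}" "{j\<in>A. z j \<le> z l} = {j\<in>A. z' j \<le> z' l}"
    if "l \<in> A \<union> B" for l
    using assms that by auto
  then show ?thesis by (simp add: precedes_def)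
qed

lemma precedes_reindex:
  assumes "inj_on p (A \<union> B)"
  shows "precedes k A B (\<lambda>j. z (p j)) \<longleftrightarrow> precedes k (p ` A) (p ` B) z"
proof -
  have card: "card {j\<in>p ` S. z j \<le> t} = card {j\<in>S. z (p j) \<le> t}" if "S \<subseteq> A \<union> B" for S t
  proof -
    have "{j\<in>p ` S. z j \<le> t} = p ` {j\<in>S. z (p j) \<le> t}" by auto
    moreover have "inj_on p {j\<in>S. z (p j) \<le> t}" using assms that by (auto intro: inj_on_subset)
    ultimately show ?thesis by (simp add: card_image)
  qed
  show ?thesis by (simp add: precedes_def card ball_Un)
qed

text \<open>Replacing the values of z by their ranks makes the count independent of z.\<close>

lemma card_precedes:
  assumes K: "finite K" and inj: "inj_on z K"
  shows "card {A. A \<subseteq> K \<and> card A = a \<and> precedes k A (K - A) z} = card (dominating_sets k (card K) a)"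
proof -
  define r where "r j = card {i\<in>K. z i < z j}" for j
  have r_le: "r j \<le> r l \<longleftrightarrow> z j \<le> z l" if "j \<in> K" "l \<in> K" for j l
  proof
    assume "z j \<le> z l"
    then show "r j \<le> r l" unfolding r_def using K by (intro card_mono) auto
  next
    assume "r j \<le> r l"
    show "z j \<le> z l"
    proof (rule ccontr)
      assume "\<not> z j \<le> z l"
      then have lt: "z l < z j" by simp
      then have "l \<in> {i\<in>K. z i < z j}" "l \<notin> {i\<in>K. z i < z l}" using that by simp_all
      moreover have "{i\<in>K. z i < z l} \<subseteq> {i\<in>K. z i < z j}"
        using lt by (blast intro: less_trans)
      ultimately have "{i\<in>K. z i < z l} \<subset> {i\<in>K. z i < z j}" by blast
      then have "r l < r j" unfolding r_def using K by (intro psubset_card_mono) auto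
      then show False using \<open>r j \<le> r l\<close> by simp
    qed
  qed
  have inj_r: "inj_on r K"
    using r_le inj by (intro inj_onI) (metis inj_onD order.antisym order.refl)
  have "r ` K \<subseteq> {..<card K}"
  proof
    fix m assume "m \<in> r ` K"
    then obtain j where "j \<in> K" "m = r j" by auto
    then have "{i\<in>K. z i < z j} \<subset> K" by auto
    then have "r j < card K" unfolding r_def using K by (intro psubset_card_mono) auto
    then show "m \<in> {..<card K}" using \<open>m = r j\<close> by simp
  qed
  then have rK: "r ` K = {..<card K}"
    using inj_r by (intro card_subset_eq) (auto simp: card_image)
  have iff: "r ` A \<in> dominating_sets k (card K) a \<longleftrightarrow> card A = a \<and> precedes k A (K - A) z"
    if A: "A \<subseteq> K" for A
  proof -
    \<comment> \<open>Ranks start at 0, so the sample values at most z l occupy exactly the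
      positions below r l + 1.\<close>
    have c: "card ({..<Suc (r l)} - r ` A) = card {j\<in>K - A. z j \<le> z l}"
      "card ({..<Suc (r l)} \<inter> r ` A) = card {j\<in>A. z j \<le> z l}" if l: "l \<in> K" for l
    proof -
      have "r l < card K" using l rK by blast
      then have sub: "{..<Suc (r l)} \<subseteq> r ` K" unfolding rK by auto
      have "{..<Suc (r l)} \<inter> r ` S = r ` {j\<in>S. z j \<le> z l}" if "S \<subseteq> K" for S
        using r_le[OF _ l] that by (force simp: less_Suc_eq_le)
      moreover have "{..<Suc (r l)} - r ` A = {..<Suc (r l)} \<inter> r ` (K - A)"
        using sub inj_on_image_set_diff[OF inj_r, of K A] A by blast
      ultimately have "{..<Suc (r l)} - r ` A = r ` {j\<in>K - A. z j \<le> z l}"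
        and "{..<Suc (r l)} \<inter> r ` A = r ` {j\<in>A. z j \<le> z l}"
        using A by auto
      moreover have "inj_on r {j\<in>K - A. z j \<le> z l}" "inj_on r {j\<in>A. z j \<le> z l}"
        using A by (auto intro: inj_on_subset[OF inj_r])
      ultimately show "card ({..<Suc (r l)} - r ` A) = card {j\<in>K - A. z j \<le> z l}"
        "card ({..<Suc (r l)} \<inter> r ` A) = card {j\<in>A. z j \<le> z l}"
        by (simp_all only: card_image)
    qed
    \<comment> \<open>The empty prefix imposes nothing, and every other prefix has length r l + 1
      for some l since r is onto.\<close>
    have "(\<forall>m\<le>card K. min k (card ({..<m} - r ` A)) \<le> card ({..<m} \<inter> r ` A))
        \<longleftrightarrow> (\<forall>m<card K. min k (card ({..<Suc m} - r ` A)) \<le> card ({..<Suc m} \<inter> r ` A))"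
    proof (intro iffI allI impI)
      fix m assume *: "\<forall>m<card K. min k (card ({..<Suc m} - r ` A)) \<le> card ({..<Suc m} \<inter> r ` A)"
        and m: "m \<le> card K"
      show "min k (card ({..<m} - r ` A)) \<le> card ({..<m} \<inter> r ` A)"
      proof (cases m)
        case 0
        then show ?thesis by simp
      next
        case (Suc m')
        then show ?thesis using * m by (simp only: Suc_le_eq)
      qed
    qed (simp only: Suc_le_eq)
    also have "\<dots> \<longleftrightarrow> (\<forall>l\<in>K. min k (card ({..<Suc (r l)} - r ` A)) \<le> card ({..<Suc (r l)} \<inter> r ` A))"
      using rK by (metis (no_types, lifting) imageE imageI lessThan_iff)
    also have "\<dots> \<longleftrightarrow> precedes k A (K - A) z"
    proof -
      have "A \<union> (K - A) = K" using A by auto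
      then show ?thesis using c by (simp add: precedes_def)
    qed
    finally have "(\<forall>m\<le>card K. min k (card ({..<m} - r ` A)) \<le> card ({..<m} \<inter> r ` A))
        \<longleftrightarrow> precedes k A (K - A) z" .
    moreover have "r ` A \<subseteq> {..<card K}" using A rK by auto
    moreover have "card (r ` A) = card A" using inj_r A by (intro card_image inj_on_subset[OF inj_r])
    ultimately show ?thesis by (simp add: dominating_sets_def)
  qed
  have "(`) r ` {A. A \<subseteq> K \<and> card A = a \<and> precedes k A (K - A) z} = dominating_sets k (card K) a"
  proof (intro equalityI subsetI)
    fix B assume B: "B \<in> dominating_sets k (card K) a"
    then have "B \<subseteq> r ` K" by (auto simp: dominating_sets_def rK)
    then obtain A where "A \<subseteq> K" "B = r ` A" by (auto simp: subset_image_iff)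
    then show "B \<in> (`) r ` {A. A \<subseteq> K \<and> card A = a \<and> precedes k A (K - A) z}"
      using B iff by auto
  qed (use iff in auto)
  moreover have "inj_on ((`) r) {A. A \<subseteq> K \<and> card A = a \<and> precedes k A (K - A) z}"
    using inj_on_image_Pow[OF inj_r] by (rule inj_on_subset) blast
  ultimately show ?thesis using card_image by fastforce
qed

text \<open>From left to right, use the index i = min k (number of x j <= t); from right to left,
  use the threshold t = \<open>order_map d x i\<close>.\<close>

lemma order_map_le_all_iff:
  assumes "k \<le> d"
  shows "(\<forall>i\<in>{1..k}. order_map d y i \<le> order_map d x i) \<longleftrightarrow>
    (\<forall>t. min k (card {j\<in>{1..d}. x j \<le> t}) \<le> card {j\<in>{1..d}. y j \<le> t})" (is "?L \<longleftrightarrow> ?R")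
proof
  assume L: ?L
  show ?R
  proof
    fix t
    define i where "i = min k (card {j\<in>{1..d}. x j \<le> t})"
    show "i \<le> card {j\<in>{1..d}. y j \<le> t}"
    proof (cases "i = 0")
      case False
      then have i: "i \<in> {1..k}" "i \<in> {1..d}" using assms by (auto simp: i_def)
      have "order_map d x i \<le> t" unfolding order_map_le_iff[OF i(2)] by (simp add: i_def)
      then have "order_map d y i \<le> t" using L i(1) by (blast intro: order_trans)
      then show ?thesis unfolding order_map_le_iff[OF i(2)] .
    qed simp
  qed
next
  assume R: ?R
  show ?L
  proof
    fix i assume "i \<in> {1..k}"
    then have i: "i \<le> k" "i \<in> {1..d}" using assms by auto
    have "i \<le> card {j\<in>{1..d}. x j \<le> order_map d x i}"
      using order_map_le_iff[OF i(2), of x "order_map d x i"] by blast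
    then have "i \<le> card {j\<in>{1..d}. y j \<le> order_map d x i}"
      using R[rule_format, of "order_map d x i"] i(1) by linarith
    then show "order_map d y i \<le> order_map d x i" unfolding order_map_le_iff[OF i(2)] .
  qed
qed

lemma measurable_precedes[measurable]:
  assumes "finite K" "A \<subseteq> K" "B \<subseteq> K"
  shows "Measurable.pred (iid K) (precedes k A B)"
proof -
  have [measurable]: "(\<lambda>z. z j) \<in> borel_measurable (iid K)" if "j \<in> A \<union> B" for j
    using assms that by (intro measurable_iid_component) auto
  have fin: "finite (A \<union> B)" using assms finite_subset by auto
  have cnt: "(\<lambda>z. card {j\<in>S. z j \<le> z l}) \<in> measurable (iid K) (count_space UNIV)"
    if "l \<in> A \<union> B" "S \<subseteq> A \<union> B" for l S
  proof (rule measurable_card)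
    fix j
    show "{z\<in>space (iid K). j \<in> {j\<in>S. z j \<le> z l}} \<in> sets (iid K)"
      using that by (cases "j \<in> S") auto
  qed
  \<comment> \<open>Naming both counts turns the inequality into a countable union of level
    sets.\<close>
  have "Measurable.pred (iid K) (\<lambda>z. \<exists>a b. card {j\<in>B. z j \<le> z l} = a \<and> card {j\<in>A. z j \<le> z l} = b \<and> min k a \<le> b)"
    if l: "l \<in> A \<union> B" for l
    using cnt[OF l, of A] cnt[OF l, of B] by measurable
  then show ?thesis
    unfolding precedes_def[abs_def] by (intro pred_intros_finite(3)[OF fin]) simp
qed

section \<open>Gluing and permuting independent samples\<close>

lemma distr_iid_reindex:
  assumes "inj_on p I" "p ` I \<subseteq> K"
  shows "distr (iid K) (iid I) (\<lambda>z. \<lambda>n\<in>I. z (p n)) = iid I"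
  unfolding iid_def using assms by (intro distr_PiM_reindex prob_space_unif) auto

lemma measurable_iid_reindex[measurable]:
  assumes "p ` I \<subseteq> K"
  shows "(\<lambda>z. \<lambda>n\<in>I. z (p n)) \<in> measurable (iid K) (iid I)"
  unfolding measurable_cong_sets[OF refl sets_iid[of I]]
  using assms by (intro measurable_restrict measurable_iid_component) auto

text \<open>Applied with the shift by d, which moves a sample to the block {d+1..2d}, and with
  permutations of {1..2d}.\<close>

lemma measure_iid_reindex:
  assumes "inj_on p I" "p ` I \<subseteq> K" and [measurable]: "Measurable.pred (iid I) Q"
  shows "measure (iid I) {y\<in>space (iid I). Q y}
    = measure (iid K) {z\<in>space (iid K). Q (\<lambda>n\<in>I. z (p n))}"
proof -
  have "measure (iid I) {y\<in>space (iid I). Q y}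
     = measure (distr (iid K) (iid I) (\<lambda>z. \<lambda>n\<in>I. z (p n))) {y\<in>space (iid I). Q y}"
    using distr_iid_reindex[OF assms(1,2)] by simp
  also have "\<dots> = measure (iid K) {z\<in>space (iid K). Q (\<lambda>n\<in>I. z (p n))}"
    using measurable_space[OF measurable_iid_reindex[OF assms(2)]]
    by (subst measure_distr[OF measurable_iid_reindex[OF assms(2)]])
       (auto intro!: arg_cong[where f = "measure (iid K)"])
  finally show ?thesis .
qed

text \<open>Fubini in reverse: the dominating sample x keeps the block {1..d}, the dominated one
  moves to {d+1..2d}, and \<open>merge\<close> reassembles them into a single sample.\<close>

lemma bracket_eq_precedes:
  assumes "k \<le> d"
  shows "bracket k (product_order_margin d k) (product_order_margin d k)
    = measure (iid {1..2 * d}) {z\<in>space (iid {1..2 * d}). precedes k {d + 1..2 * d} {1..d} z}"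
proof -
  let ?I = "{1..d}" and ?J = "{d + 1..2 * d}" and ?K = "{1..2 * d}"
  interpret J: prob_space "iid ?J" by (rule prob_space_iid)
  interpret product_sigma_finite "\<lambda>_::nat. unif" by (rule product_sigma_finite_unif)
  have K: "?I \<union> ?J = ?K" by auto
  have fm: "merge ?I ?J (x, w) \<in> space (iid ?K)" for x w
    unfolding K[symmetric] space_iid by auto
  define E where "E = {z\<in>space (iid ?K). precedes k ?J ?I z}"
  have E[measurable]: "E \<in> sets (iid ?K)"
    unfolding E_def by (intro predE measurable_precedes) auto
  have merge[measurable]: "(\<lambda>w. merge ?I ?J (x, w)) \<in> measurable (iid ?J) (iid ?K)" if "x \<in> space (iid ?I)" for x
    using that unfolding iid_def K[symmetric] by measurable
  \<comment> \<open>For fixed x the domination event is a section of E once y has been shifted to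
    the second block.\<close>
  have sec: "measure (iid ?I) {y\<in>space (iid ?I). \<forall>i\<in>{1..k}. order_map d y i \<le> order_map d x i}
     = measure (iid ?J) {w\<in>space (iid ?J). merge ?I ?J (x, w) \<in> E}" for x
  proof -
    have [measurable]: "(\<lambda>y. order_map d y i) \<in> borel_measurable (iid {1..d})" if "i \<in> {1..k}" for i
      using that assms by (auto intro!: measurable_order_map_component)
    have "measure (iid ?I) {y\<in>space (iid ?I). \<forall>i\<in>{1..k}. order_map d y i \<le> order_map d x i}
        = measure (iid ?J) {w\<in>space (iid ?J).
            \<forall>i\<in>{1..k}. order_map d (\<lambda>n\<in>?I. w (n + d)) i \<le> order_map d x i}"
      by (rule measure_iid_reindex[where p = "\<lambda>n. n + d"]) auto
    moreover have "(\<forall>i\<in>{1..k}. order_map d (\<lambda>n\<in>?I. w (n + d)) i \<le> order_map d x i)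
        \<longleftrightarrow> merge ?I ?J (x, w) \<in> E" for w
    proof -
      have 1: "{j\<in>?I. merge ?I ?J (x, w) j \<le> t} = {j\<in>?I. x j \<le> t}" for t
        by (auto simp: merge_def)
      have "{j\<in>?J. merge ?I ?J (x, w) j \<le> t} = (\<lambda>n. n + d) ` {j\<in>?I. (\<lambda>n\<in>?I. w (n + d)) j \<le> t}" for t
      proof (intro equalityI subsetI)
        fix j assume "j \<in> {j\<in>?J. merge ?I ?J (x, w) j \<le> t}"
        then have "j = (j - d) + d" "j - d \<in> {j\<in>?I. (\<lambda>n\<in>?I. w (n + d)) j \<le> t}"
          by (auto simp: merge_def)
        then show "j \<in> (\<lambda>n. n + d) ` {j\<in>?I. (\<lambda>n\<in>?I. w (n + d)) j \<le> t}" by blast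
      qed (auto simp: merge_def)
      then have 2: "card {j\<in>?J. merge ?I ?J (x, w) j \<le> t} = card {j\<in>?I. (\<lambda>n\<in>?I. w (n + d)) j \<le> t}" for t
        by (simp add: card_image)
      show ?thesis
        unfolding order_map_le_all_iff[OF assms] E_def mem_Collect_eq
        using fm precedes_iff[OF finite_atLeastAtMost finite_atLeastAtMost, of k "d + 1" "2 * d" 1 d "merge ?I ?J (x, w)"]
        by (simp only: 1 2 simp_thms)
    qed
    ultimately show ?thesis by (simp only:)
  qed
  have "emeasure (iid ?K) E = (\<integral>\<^sup>+z. indicator E z \<partial>PiM (?I \<union> ?J) (\<lambda>_. unif))"
    unfolding K iid_def[symmetric] by simp
  also have "\<dots> = (\<integral>\<^sup>+x. (\<integral>\<^sup>+w. indicator E (merge ?I ?J (x, w)) \<partial>iid ?J) \<partial>iid ?I)"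
    unfolding iid_def
  proof (rule product_nn_integral_fold)
    show "indicator E \<in> borel_measurable (PiM (?I \<union> ?J) (\<lambda>_. unif))"
      unfolding K iid_def[symmetric] by measurable
  qed auto
  also have "\<dots> = (\<integral>\<^sup>+x. ennreal (measure (iid ?J) {w\<in>space (iid ?J). merge ?I ?J (x, w) \<in> E}) \<partial>iid ?I)"
  proof (rule nn_integral_cong)
    fix x assume x: "x \<in> space (iid ?I)"
    have [measurable]: "{w\<in>space (iid ?J). merge ?I ?J (x, w) \<in> E} \<in> sets (iid ?J)"
      using merge[OF x] by measurable
    have "(\<integral>\<^sup>+w. indicator E (merge ?I ?J (x, w)) \<partial>iid ?J)
       = (\<integral>\<^sup>+w. indicator {w\<in>space (iid ?J). merge ?I ?J (x, w) \<in> E} w \<partial>iid ?J)"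
      by (intro nn_integral_cong) (simp add: indicator_def)
    then show "(\<integral>\<^sup>+w. indicator E (merge ?I ?J (x, w)) \<partial>iid ?J)
       = ennreal (measure (iid ?J) {w\<in>space (iid ?J). merge ?I ?J (x, w) \<in> E})"
      by (simp add: J.emeasure_eq_measure)
  qed
  finally have "emeasure (iid ?K) E
     = (\<integral>\<^sup>+x. ennreal (measure (iid ?J) {w\<in>space (iid ?J). merge ?I ?J (x, w) \<in> E}) \<partial>iid ?I)" .
  moreover have "bracket k (product_order_margin d k) (product_order_margin d k)
    = enn2real (\<integral>\<^sup>+x. ennreal (measure (iid ?J) {w\<in>space (iid ?J). merge ?I ?J (x, w) \<in> E}) \<partial>iid ?I)"
    unfolding bracket_product_order_margin[OF assms] sec
  proof (rule integral_eq_nn_integral)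
    have "(\<lambda>x. emeasure (iid ?J) {w\<in>space (iid ?J). merge ?I ?J (x, w) \<in> E}) \<in> borel_measurable (iid ?I)"
    proof (rule J.measurable_emeasure)
      have [measurable]: "merge ?I ?J \<in> measurable (iid ?I \<Otimes>\<^sub>M iid ?J) (iid ?K)"
        unfolding iid_def K[symmetric] by measurable
      have "{p\<in>space (iid ?I \<Otimes>\<^sub>M iid ?J). merge ?I ?J p \<in> E} \<in> sets (iid ?I \<Otimes>\<^sub>M iid ?J)"
        by measurable
      also have "{p\<in>space (iid ?I \<Otimes>\<^sub>M iid ?J). merge ?I ?J p \<in> E}
          = {p\<in>space (iid ?I \<Otimes>\<^sub>M iid ?J). snd p \<in> {w\<in>space (iid ?J). merge ?I ?J (fst p, w) \<in> E}}"
        by (auto simp: space_pair_measure)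
      finally show "\<dots> \<in> sets (iid ?I \<Otimes>\<^sub>M iid ?J)" .
    qed auto
    then show "(\<lambda>x. measure (iid ?J) {w\<in>space (iid ?J). merge ?I ?J (x, w) \<in> E}) \<in> borel_measurable (iid ?I)"
      unfolding measure_def by measurable
  qed auto
  ultimately show ?thesis by (simp add: measure_def E_def)
qed

text \<open>A permutation carrying {d+1..2d} to A and {1..d} to its complement preserves the joint
  law, so any d-subset may play the dominated sample.\<close>

lemma measure_precedes_perm:
  assumes "A \<subseteq> {1..2 * d}" "card A = d"
  shows "measure (iid {1..2 * d}) {z\<in>space (iid {1..2 * d}). precedes k A ({1..2 * d} - A) z}
    = measure (iid {1..2 * d}) {z\<in>space (iid {1..2 * d}). precedes k {d + 1..2 * d} {1..d} z}"
proof -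
  let ?I = "{1..d}" and ?J = "{d + 1..2 * d}" and ?K = "{1..2 * d}"
  have fin: "finite A" using assms finite_subset by auto
  obtain f where f: "bij_betw f ?J A"
    using finite_same_card_bij[of ?J A] fin assms by auto
  obtain g where g: "bij_betw g ?I (?K - A)"
    using finite_same_card_bij[of ?I "?K - A"] fin assms by (auto simp: card_Diff_subset)
  define p where "p n = (if n \<in> ?J then f n else g n)" for n
  have pJ: "bij_betw p ?J A"
    using f by (rule bij_betw_cong[THEN iffD1, rotated]) (simp add: p_def)
  have pI: "bij_betw p ?I (?K - A)"
    using g by (rule bij_betw_cong[THEN iffD1, rotated]) (auto simp: p_def)
  have "bij_betw p (?J \<union> ?I) (A \<union> (?K - A))"
    by (rule bij_betw_combine[OF pJ pI]) auto
  moreover have "?J \<union> ?I = ?K" "A \<union> (?K - A) = ?K" using assms by auto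
  ultimately have inj: "inj_on p ?K" and im: "p ` ?K \<subseteq> ?K" by (auto simp: bij_betw_def)
  have "precedes k ?J ?I (\<lambda>n\<in>?K. z (p n)) \<longleftrightarrow> precedes k A (?K - A) z" for z :: "nat \<Rightarrow> ereal"
  proof -
    have "precedes k ?J ?I (\<lambda>n\<in>?K. z (p n)) \<longleftrightarrow> precedes k ?J ?I (\<lambda>n. z (p n))"
      by (rule precedes_cong) auto
    also have "\<dots> \<longleftrightarrow> precedes k (p ` ?J) (p ` ?I) z"
      by (rule precedes_reindex) (rule inj_on_subset[OF inj], auto)
    finally show ?thesis using pJ pI by (simp add: bij_betw_def)
  qed
  moreover have "Measurable.pred (iid ?K) (precedes k ?J ?I)"
    by (rule measurable_precedes) auto
  ultimately show ?thesis
    using measure_iid_reindex[OF inj im, of "precedes k ?J ?I"] by simp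
qed

text \<open>Double counting: summing the equal probabilities over all d-subsets A gives the expected
  number of A whose event occurs. Without ties this number is the constant of
  \<open>card_precedes\<close>, and ties have probability 0.\<close>

lemma bracket_eq_dominating_sets:
  assumes "k \<le> d"
  shows "bracket k (product_order_margin d k) (product_order_margin d k)
    = real (card (dominating_sets k (2 * d) d)) / real (2 * d choose d)"
proof -
  let ?K = "{1..2 * d}"
  interpret prob_space "iid ?K" by (rule prob_space_iid)
  define SS where "SS = {A. A \<subseteq> ?K \<and> card A = d}"
  have fin: "finite SS" by (rule finite_subset[of _ "Pow ?K"]) (auto simp: SS_def)
  have card: "card SS = 2 * d choose d" unfolding SS_def using n_subsets[of ?K d] by simp
  define ev where "ev A = {z\<in>space (iid ?K). precedes k A (?K - A) z}" for A
  have ev[measurable]: "ev A \<in> sets (iid ?K)" if "A \<in> SS" for A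
    unfolding ev_def using that by (intro predE measurable_precedes) (auto simp: SS_def)
  have "real (2 * d choose d) * bracket k (product_order_margin d k) (product_order_margin d k)
      = (\<Sum>A\<in>SS. prob (ev A))"
    unfolding bracket_eq_precedes[OF assms] card[symmetric]
    using measure_precedes_perm[of _ d k] by (simp add: ev_def SS_def)
  also have "\<dots> = (\<Sum>A\<in>SS. \<integral>z. indicator (ev A) z \<partial>iid ?K)"
    by (intro sum.cong) (auto simp: ev_def Int_def conj_commute)
  also have "\<dots> = (\<integral>z. (\<Sum>A\<in>SS. indicator (ev A) z) \<partial>iid ?K)"
    by (intro Bochner_Integration.integral_sum[symmetric] integrable_real_indicator) (auto simp: emeasure_eq_measure)
  also have "\<dots> = (\<integral>z. real (card (dominating_sets k (2 * d) d)) \<partial>iid ?K)"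
  proof (rule integral_cong_AE)
    show "AE z in iid ?K. (\<Sum>A\<in>SS. indicator (ev A) z) = real (card (dominating_sets k (2 * d) d))"
      using AE_iid_inj[of ?K, OF finite_atLeastAtMost] AE_space
    proof eventually_elim
      case (elim z)
      have "(\<Sum>A\<in>SS. indicator (ev A) z :: real) = real (card {A\<in>SS. precedes k A (?K - A) z})"
        using fin elim(2) by (simp add: indicator_def ev_def sum.If_cases Int_def)
      also have "{A\<in>SS. precedes k A (?K - A) z} = {A. A \<subseteq> ?K \<and> card A = d \<and> precedes k A (?K - A) z}"
        by (auto simp: SS_def)
      also have "card \<dots> = card (dominating_sets k (2 * d) d)"
        using card_precedes[OF finite_atLeastAtMost elim(1), of d k] by simp
      finally show ?case .
    qed
  qed (auto intro!: borel_measurable_sum)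
  also have "\<dots> = real (card (dominating_sets k (2 * d) d))"
    using prob_space by simp
  finally show ?thesis by (simp add: field_simps)
qed

section \<open>Evaluation of the bracket and of Kendall's tau\<close>

lemma ballot_diag: "real_of_int (ballot j j) = real (2 * j choose j) / (real j + 1)"
proof -
  \<comment> \<open>Absorption expresses the reflected term as j/(j+1) times the central binomial,
    leaving the Catalan number.\<close>
  have "Suc j * (2 * j choose Suc j) = (2 * j - j) * (2 * j choose j)"
    by (metis binomial_absorb_comp binomial_absorption)
  then have "real (Suc j * (2 * j choose Suc j)) = real (j * (2 * j choose j))" by simp
  then show ?thesis by (simp add: ballot_def field_simps flip: mult_2)
qed

text \<open>The factor 1/4 collects two halves: with h = j + 1, (2h choose h)/(2h-1) is twice the
  Catalan number of index j, and the other central binomial is twice the number of rests.\<close>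

lemma first_crossing_tau_term:
  assumes "j < d"
  shows "real_of_int (first_crossing j d d) / real (2 * d choose d) = 1 / 4 * tau_term d (Suc j)"
proof -
  obtain m where d: "d = Suc (j + m)" using assms less_imp_Suc_add by blast
  have 1: "2 * d + 2 - 2 * Suc j = 2 * Suc m" "d + 1 - Suc j = Suc m" "d + d - 1 - 2 * j = 2 * m + 1" "d - j = Suc m"
    by (auto simp: d)
  \<comment> \<open>The rest has an odd number 2m + 1 of steps, so symmetry of its binomial row
    makes it half of a central binomial.\<close>
  have "(2 * m + 1) choose m = (2 * m + 1) choose Suc m"
    using binomial_symmetric[of m "2 * m + 1"] by (simp add: One_nat_def)
  then have "2 * Suc m choose Suc m = 2 * ((2 * m + 1) choose Suc m)" by (simp add: One_nat_def)
  then have 2: "real (2 * Suc m choose Suc m) = 2 * real ((2 * m + 1) choose Suc m)"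
    by (metis of_nat_mult of_nat_numeral)
  define q where "q = real ((2 * m + 1) choose Suc m)"
  have 3: "2 * real (Suc j) - 1 = 2 * real j + 1" by simp
  have 4: "real_of_int (first_crossing j d d) = real_of_int (ballot j j) * q"
    using assms by (simp only: first_crossing_def 1 q_def) simp
  have "2 * real j + 1 > 0" "real j + 1 > 0" by auto
  then show ?thesis
    unfolding tau_term_def 1 2 3 4 central_binomial_Suc[of j] ballot_diag q_def[symmetric]
    by (simp add: divide_simps)
qed

lemma bracket_product_order_margin_value:
  assumes "1 \<le> k" "k \<le> d"
  shows "bracket k (product_order_margin d k) (product_order_margin d k)
    = 1 / 2 - 1 / 4 * (\<Sum>h = 2..k. tau_term d h)"
proof -
  let ?b = "real (2 * d choose d)"
  have "real (card (dominating_sets k (2 * d) d)) = real_of_int (dominating_count k d d)"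
    using card_dominating_sets[of k d d] assms by (simp flip: mult_2)
  then have "bracket k (product_order_margin d k) (product_order_margin d k)
      = real_of_int (dominating_count k d d) / ?b"
    using bracket_eq_dominating_sets[OF assms(2)] by simp
  also have "\<dots> = 1 - (\<Sum>j<k. real_of_int (first_crossing j d d) / ?b)"
    by (simp add: dominating_count_def diff_divide_distrib sum_divide_distrib flip: mult_2)
  also have "(\<Sum>j<k. real_of_int (first_crossing j d d) / ?b) = (\<Sum>j<k. 1 / 4 * tau_term d (Suc j))"
    using assms by (intro sum.cong first_crossing_tau_term) auto
  also have "\<dots> = (\<Sum>h = 1..k. 1 / 4 * tau_term d h)"
    by (rule sum.reindex_bij_witness[of _ "\<lambda>h. h - 1" Suc]) auto
  \<comment> \<open>The term h = 1 stands for the paths beginning with a down step. They have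
    probability 1/2, which turns the leading 1 into 1/2.\<close>
  also have "\<dots> = 1 / 4 * tau_term d 1 + (\<Sum>h = 2..k. 1 / 4 * tau_term d h)"
    using assms by (simp add: sum.atLeast_Suc_atMost numeral_2_eq_2 One_nat_def)
  also have "tau_term d 1 = 2" by (simp add: tau_term_def One_nat_def)
  finally show ?thesis by (simp add: sum_distrib_left)
qed

lemma kendall_tau_product_order_margin:
  assumes "2 \<le> k" "k \<le> d"
  shows "kendall_tau k (product_order_margin d k) = tau_formula d k"
proof -
  obtain j where j: "k = 2 + j" using le_Suc_ex[OF assms(1)] by blast
  define p :: real where "p = 2 ^ j"
  have pows: "2 ^ (k - 2) = p" "2 ^ (k - 1) = 2 * p" "2 ^ k = 4 * p" by (simp_all add: p_def j)
  have k: "1 \<le> k" using assms by simp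
  have "p \<ge> 1" by (simp add: p_def)
  then have p: "2 * p - 1 \<noteq> 0" by simp
  have "(4 * p * (1 / 2 - 1 / 4 * S) - 1) / (2 * p - 1) = 1 - p / (2 * p - 1) * S" for S
  proof -
    have e: "4 * p * (1 / 2 - 1 / 4 * S) - 1 = (2 * p - 1) - p * S" by (simp add: right_diff_distrib)
    show ?thesis unfolding e diff_divide_distrib[of "2 * p - 1"] using p by simp
  qed
  then show ?thesis
    unfolding kendall_tau_def tau_formula_def bracket_product_order_margin_value[OF k assms(2)] pows .
qed

theorem corollary6p4:
  shows "(\<forall>d\<ge>2. \<forall>k\<in>{2..d}.
            bracket k (product_order_margin d k) (product_order_margin d k)
              = 1 / 2 - 1 / 4 * (\<Sum>h = 2..k. 1 / (2 * real h - 1) * real (2 * h choose h)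
                  * real ((2 * d + 2 - 2 * h) choose (d + 1 - h)) / real (2 * d choose d))
          \<and> bracket k (product_order_margin d k) (product_order_margin d k)
              = 1 / (real d + 1) + 1 / (2 * real d) * (\<Sum>l = 1..d - k.
                  real (d choose (l - 1)) * real (d choose l)
                    / real ((2 * d - 1) choose (2 * l - 1))))
       \<and> (\<forall>d\<ge>2. \<forall>k\<in>{2..d}.
            kendall_tau k (product_order_margin d k)
              = 1 - 2 ^ (k - 2) / (2 ^ (k - 1) - 1)
                  * (\<Sum>h = 2..k. 1 / (2 * real h - 1) * real (2 * h choose h)
                      * real ((2 * d + 2 - 2 * h) choose (d + 1 - h)) / real (2 * d choose d)))
       \<and> (\<forall>d\<ge>2. strict_antimono_on {2..d} (\<lambda>k. kendall_tau k (product_order_margin d k))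
            \<and> bracket d (product_order_margin d d) (product_order_margin d d) = 1 / (real d + 1)
            \<and> kendall_tau d (product_order_margin d d)
                = (2 ^ d / (real d + 1) - 1) / (2 ^ (d - 1) - 1))
       \<and> (\<forall>k\<ge>2. strict_mono_on {k..} (\<lambda>d. kendall_tau k (product_order_margin d k))
            \<and> (\<lambda>d. kendall_tau k (product_order_margin d k))
                \<longlonglongrightarrow> 1 - 2 ^ (k - 2) / (2 ^ (k - 1) - 1)
                  * (\<Sum>h = 2..k. 1 / (2 * real h - 1) * real (2 * h choose h)
                      * (1 / 2 ^ (2 * h - 2))))"
proof -
  have bracket: "bracket k (product_order_margin d k) (product_order_margin d k)
      = 1 / 2 - 1 / 4 * (\<Sum>h = 2..k. tau_term d h)" if "k \<in> {2..d}" for d k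
    using that by (intro bracket_product_order_margin_value) auto
  have tau: "kendall_tau k (product_order_margin d k) = tau_formula d k" if "k \<in> {2..d}" for d k
    using that by (intro kendall_tau_product_order_margin) auto
  have full: "bracket d (product_order_margin d d) (product_order_margin d d) = 1 / (real d + 1)"
    if "d \<ge> 2" for d
    using bracket[of d d] sum_tau_term_full[of d] that by simp
  show ?thesis
  proof (intro conjI allI impI ballI)
    fix d k :: nat assume dk: "2 \<le> d" "k \<in> {2..d}"
    show "bracket k (product_order_margin d k) (product_order_margin d k)
        = 1 / 2 - 1 / 4 * (\<Sum>h = 2..k. 1 / (2 * real h - 1) * real (2 * h choose h)
            * real ((2 * d + 2 - 2 * h) choose (d + 1 - h)) / real (2 * d choose d))"
      using bracket[OF dk(2)] unfolding tau_term_def .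
    show "bracket k (product_order_margin d k) (product_order_margin d k)
        = 1 / (real d + 1) + 1 / (2 * real d) * (\<Sum>l = 1..d - k.
            real (d choose (l - 1)) * real (d choose l) / real ((2 * d - 1) choose (2 * l - 1)))"
      unfolding bracket[OF dk(2)] by (rule sum_tau_term_tail) (use dk in auto)
    show "kendall_tau k (product_order_margin d k)
        = 1 - 2 ^ (k - 2) / (2 ^ (k - 1) - 1)
            * (\<Sum>h = 2..k. 1 / (2 * real h - 1) * real (2 * h choose h)
                * real ((2 * d + 2 - 2 * h) choose (d + 1 - h)) / real (2 * d choose d))"
      using tau[OF dk(2)] unfolding tau_formula_def tau_term_def .
  next
    fix d :: nat assume d: "2 \<le> d"
    show "strict_antimono_on {2..d} (\<lambda>k. kendall_tau k (product_order_margin d k))"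
      using tau_formula_antimono[of d] tau unfolding monotone_on_def by simp
    show "bracket d (product_order_margin d d) (product_order_margin d d) = 1 / (real d + 1)"
      using full[OF d] .
    show "kendall_tau d (product_order_margin d d) = (2 ^ d / (real d + 1) - 1) / (2 ^ (d - 1) - 1)"
      unfolding kendall_tau_def full[OF d] by simp
  next
    fix k :: nat assume k: "2 \<le> k"
    show "strict_mono_on {k..} (\<lambda>d. kendall_tau k (product_order_margin d k))"
      using tau_formula_mono[OF k] tau k unfolding monotone_on_def by simp
    show "(\<lambda>d. kendall_tau k (product_order_margin d k))
        \<longlonglongrightarrow> 1 - 2 ^ (k - 2) / (2 ^ (k - 1) - 1)
          * (\<Sum>h = 2..k. 1 / (2 * real h - 1) * real (2 * h choose h) * (1 / 2 ^ (2 * h - 2)))"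
      using tau_formula_tendsto[of k]
      by (rule Lim_transform_eventually)
         (use eventually_ge_at_top[of k] in eventually_elim, use tau k in simp)
  qed
qed

end
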